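(* Let $M$ be an $n$-dimensional Riemannian manifold with Ricci form $Ric$. (a) If $x:M\to H^{n+1}$ is an immersed hypersurface with mean curvature $H=\frac1n \mathrm{tr}(\mathrm{II})$, then $$\mathrm{IV}=\eta_{n+1}^{2}\,\mathrm{I}-2\eta_{n+1}\,\mathrm{II}+\mathrm{III},$$ where $\mathrm{III}=nH\,\mathrm{II}-(n-1)\,\mathrm{I}-Ric$ is Obata's third fundamental form of $x(M)$. (b) If $x:M\to S_1^{n+1}$ is a space-like immersed hypersurface with mean curvature $H=\frac1n \mathrm{tr}(\mathrm{II})$, then $$\mathrm{IV}=\eta_{n+1}^{2}\,\mathrm{I}+2\eta_{n+1}\,\mathrm{II}+\mathrm{III},$$ where $\mathrm{III}=nH\,\mathrm{II}-(n-1)\,\mathrm{I}+Ric$ is Obata's third fundamental form of $x(M)$.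
   Context: Ambient spaces. Let $R_+^{n+1}=\{(x_1,\dots,x_{n+1})\in\mathbb R^{n+1}: x_{n+1}>0\}$. $H^{n+1}$ is $R_+^{n+1}$ with the Riemannian metric $\frac{1}{x_{n+1}^2}(dx_1^2+\cdots+dx_{n+1}^2)$ (hyperbolic space). $S_1^{n+1}$ (upper half-space model of de Sitter space) is $R_+^{n+1}$ with the Lorentz metric $\frac{1}{x_{n+1}^2}(dx_1^2+\cdots+dx_n^2-dx_{n+1}^2)$. Hypersurfaces. $x:M\to H^{n+1}$ (resp. $x:M\to S_1^{n+1}$) is an immersed (resp. space-like immersed) hypersurface, $M$ carrying the induced Riemannian metric $\mathrm I=g_{ij}du_idu_j$. Its unit normal (resp. time-like unit normal) is written $N=\sum_{A=1}^{n+1}x_{n+1}\eta_A\frac{\partial}{\partial x_A}$, with $\eta_1^2+\cdots+\eta_{n+1}^2=1$ (resp. $\eta_1^2+\cdots+\eta_n^2-\eta_{n+1}^2=-1$). The second fundamental form $\mathrm{II}=h_{ij}du_idu_j$ is defined, with $D$ the ambient and $\nabla$ the induced Levi-Civita connection, by $D_XY=\nabla_XY+\mathrm{II}(X,Y)N$ in both cases; equivalently the Weingarten formula is $\frac{\partial\eta_A}{\partial u_k}=\frac1{x_{n+1}}\left(\eta_{n+1}\frac{\partial x_A}{\partial u_k}\mp g^{jl}h_{kl}\frac{\partial x_A}{\partial u_j}\right)$, with $-$ for $H^{n+1}$ and $+$ for $S_1^{n+1}$. The trace is taken with respect to $\mathrm I$. Normal Gauss map. It is the map $\widetilde N=(\eta_1,\dots,\eta_{n+1})$,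 with values in the unit sphere $S^n(1)\subset\mathbb R^{n+1}$ for $H^{n+1}$, and in $\{-1\text{-hyperboloid}\}=H^n(-1)\subset L^{n+1}$ for $S_1^{n+1}$, where $L^{n+1}$ is $\mathbb R^{n+1}$ with the Lorentz-Minkowski product $dx_1^2+\cdots+dx_n^2-dx_{n+1}^2$ (it is the left translate of $N$ to the identity $(0,\dots,0,1)$ for a Lie group structure on $R_+^{n+1}$ making $x_{n+1}\partial/\partial x_A$ left-invariant). Fourth fundamental form. $\mathrm{IV}=\langle d\widetilde N,d\widetilde N\rangle$, with $\langle\cdot,\cdot\rangle$ the Euclidean metric of $\mathbb R^{n+1}$ for $H^{n+1}$, and the Lorentz-Minkowski metric of $L^{n+1}$ for $S_1^{n+1}$. Obata's third fundamental form of the hypersurface is $\mathrm{III}=g^{kl}h_{ik}h_{jl}\,du_idu_j$. *)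

theory Defs
  imports "HOL-Analysis.Analysis"
begin

definition dir_deriv :: "('a::real_normed_vector \<Rightarrow> 'b::real_normed_vector) \<Rightarrow> 'a \<Rightarrow> 'a \<Rightarrow> 'b"
  where "dir_deriv f u v = frechet_derivative f (at u) v"

text \<open>Both notions below are meant for open \<open>U\<close>.\<close>

primrec Ck_on :: "nat \<Rightarrow> 'a::real_normed_vector set \<Rightarrow> ('a \<Rightarrow> 'b::real_normed_vector) \<Rightarrow> bool" where
  "Ck_on 0 U f \<longleftrightarrow> continuous_on U f"
| "Ck_on (Suc k) U f \<longleftrightarrow>
     (\<forall>u\<in>U. f differentiable (at u)) \<and> (\<forall>v. Ck_on k U (\<lambda>u. dir_deriv f u v))"

definition smooth_on :: "'a::real_normed_vector set \<Rightarrow> ('a \<Rightarrow> 'b::real_normed_vector) \<Rightarrow> bool"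
  where "smooth_on U f \<longleftrightarrow> (\<forall>k. Ck_on k U f)"


text \<open>A manifold is a type \<open>'m\<close> with its topology and a smooth atlas. A chart is a pair
  \<open>(V, \<phi>)\<close> of a domain and a coordinate map, and \<open>in_chart (V, \<phi>) f\<close> is \<open>f\<close> as a function of the
  coordinates; it is meaningful on \<open>\<phi> ` V\<close> only. Tangent vectors at \<open>p \<in> V\<close>, and hence tensors
  at \<open>p\<close>, are written in the coordinates of a chart: \<open>v :: real ^ 'n\<close> stands for
  the vector with components \<open>v $ i\<close> in the basis of coordinate fields.\<close>

type_synonym ('m, 'a) chart = "'m set \<times> ('m \<Rightarrow> 'a)"

definition in_chart :: "('m, 'a) chart \<Rightarrow> ('m \<Rightarrow> 'b) \<Rightarrow> 'a \<Rightarrow> 'b"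
  where "in_chart c f = f \<circ> inv_into (fst c) (snd c)"

definition smooth_atlas :: "('m::topological_space, 'a::euclidean_space) chart set \<Rightarrow> bool"
  where "smooth_atlas \<A> \<longleftrightarrow>
    (\<Union>(V, \<phi>)\<in>\<A>. V) = UNIV \<and>
    (\<forall>(V, \<phi>)\<in>\<A>. open V \<and> open (\<phi> ` V) \<and> homeomorphism V (\<phi> ` V) \<phi> (inv_into V \<phi>)) \<and>
    (\<forall>(V, \<phi>)\<in>\<A>. \<forall>(W, \<psi>)\<in>\<A>. smooth_on (\<phi> ` (V \<inter> W)) (in_chart (V, \<phi>) \<psi>))"

definition smooth_map :: "('m, 'a::euclidean_space) chart set \<Rightarrow> ('m \<Rightarrow> 'b::euclidean_space) \<Rightarrow> bool"
  where "smooth_map \<A> f \<longleftrightarrow> (\<forall>(V, \<phi>)\<in>\<A>. smooth_on (\<phi> ` V) (in_chart (V, \<phi>) f))"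

definition immersion :: "('m, 'a::euclidean_space) chart set \<Rightarrow> ('m \<Rightarrow> 'b::euclidean_space) \<Rightarrow> bool"
  where "immersion \<A> f \<longleftrightarrow> smooth_map \<A> f \<and>
    (\<forall>(V, \<phi>)\<in>\<A>. \<forall>u\<in>\<phi> ` V. inj (dir_deriv (in_chart (V, \<phi>) f) u))"


text \<open>\<open>G p v w\<close> is the value at \<open>p\<close> of a (pseudo-)Riemannian metric on the vectors \<open>v\<close> and \<open>w\<close>.\<close>

type_synonym 'a metric = "'a \<Rightarrow> 'a \<Rightarrow> 'a \<Rightarrow> real"

text \<open>The covariant derivative, at \<open>p\<close> and in direction \<open>v\<close>, of the vector field with constant
  components \<open>w\<close>, given by the Koszul formula. For basis vectors its components
  are the Christoffel symbols.\<close>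

definition christoffel :: "'a::euclidean_space metric \<Rightarrow> 'a \<Rightarrow> 'a \<Rightarrow> 'a \<Rightarrow> 'a"
  where "christoffel G p v w =
    (THE c. \<forall>z. 2 * G p c z =
        dir_deriv (\<lambda>q. G q w z) p v + dir_deriv (\<lambda>q. G q v z) p w - dir_deriv (\<lambda>q. G q v w) p z)"

text \<open>The covariant derivative in direction \<open>v\<close> of a vector field \<open>Y\<close> along a map \<open>y\<close>.\<close>

definition cov_deriv_along ::
    "'b::euclidean_space metric \<Rightarrow> ('a::euclidean_space \<Rightarrow> 'b) \<Rightarrow> ('a \<Rightarrow> 'b) \<Rightarrow> 'a \<Rightarrow> 'a \<Rightarrow> 'b"
  where "cov_deriv_along G y Y u v =
    dir_deriv Y u v + christoffel G (y u) (dir_deriv y u v) (Y u)"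

definition riemann :: "'a::euclidean_space metric \<Rightarrow> 'a \<Rightarrow> 'a \<Rightarrow> 'a \<Rightarrow> 'a \<Rightarrow> 'a"
  where "riemann G p v w z =
      dir_deriv (\<lambda>q. christoffel G q w z) p v - dir_deriv (\<lambda>q. christoffel G q v z) p w
    + christoffel G p v (christoffel G p w z) - christoffel G p w (christoffel G p v z)"

text \<open>Sign convention: the unit \<open>n\<close>-sphere has Ricci form \<open>(n - 1)\<close> times its metric.\<close>

definition ricci :: "'a::euclidean_space metric \<Rightarrow> 'a \<Rightarrow> 'a \<Rightarrow> 'a \<Rightarrow> real"
  where "ricci G p w z = (\<Sum>b\<in>Basis. riemann G p b w z \<bullet> b)"

text \<open>The inverse matrix \<open>g\<^sup>k\<^sup>l\<close> of a scalar product \<open>g\<close> on \<open>real ^ 'n\<close>, and the trace of a bilinear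
  form with respect to \<open>g\<close>.\<close>

definition inverse_metric :: "(real ^ 'n \<Rightarrow> real ^ 'n \<Rightarrow> real) \<Rightarrow> real ^ 'n ^ 'n"
  where "inverse_metric g = matrix_inv (\<chi> i j. g (axis i 1) (axis j 1))"

definition metric_trace ::
    "(real ^ 'n \<Rightarrow> real ^ 'n \<Rightarrow> real) \<Rightarrow> (real ^ 'n \<Rightarrow> real ^ 'n \<Rightarrow> real) \<Rightarrow> real"
  where "metric_trace g B =
    (\<Sum>k\<in>UNIV. \<Sum>l\<in>UNIV. inverse_metric g $ k $ l * B (axis k 1) (axis l 1))"


text \<open>\<open>R\<^sup>n\<^sup>+\<^sup>1\<close> is \<open>(real ^ 'n) \<times> real\<close>, so the last coordinate of \<open>p\<close> is \<open>snd p\<close>, and the inner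
  product \<open>\<bullet>\<close> of the product type is the Euclidean one.\<close>

definition lorentz :: "(real ^ 'n) \<times> real \<Rightarrow> (real ^ 'n) \<times> real \<Rightarrow> real"
  where "lorentz v w = fst v \<bullet> fst w - snd v * snd w"

definition upper_half_space :: "((real ^ 'n) \<times> real) set"
  where "upper_half_space = {p. snd p > 0}"

definition hyperbolic_metric :: "((real ^ 'n) \<times> real) metric"
  where "hyperbolic_metric p v w = (v \<bullet> w) / (snd p)\<^sup>2"

definition de_sitter_metric :: "((real ^ 'n) \<times> real) metric"
  where "de_sitter_metric p v w = lorentz v w / (snd p)\<^sup>2"


text \<open>In the following definitions \<open>y\<close> and \<open>e\<close> are the immersion and the normal Gauss map
  in a chart.\<close>

definition first_form ::
    "((real ^ 'n) \<times> real) metric \<Rightarrow> (real ^ 'n \<Rightarrow> (real ^ 'n) \<times> real) \<Rightarrow> (real ^ 'n) metric"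
  where "first_form G y u v w = G (y u) (dir_deriv y u v) (dir_deriv y u w)"

text \<open>The coefficient of the normal \<open>x\<^sub>n\<^sub>+\<^sub>1 \<eta>\<close> in \<open>D\<^sub>X Y = \<nabla>\<^sub>X Y + II(X, Y) N\<close>, where \<open>X\<close> and \<open>Y\<close>
  have the constant components \<open>v\<close> and \<open>w\<close> in the chart.\<close>

definition second_form ::
    "((real ^ 'n) \<times> real) metric \<Rightarrow> (real ^ 'n \<Rightarrow> (real ^ 'n) \<times> real) \<Rightarrow>
     (real ^ 'n \<Rightarrow> (real ^ 'n) \<times> real) \<Rightarrow> real ^ 'n \<Rightarrow> real ^ 'n \<Rightarrow> real ^ 'n \<Rightarrow> real"
  where "second_form G y e u v w =
    (THE h. cov_deriv_along G y (\<lambda>u. dir_deriv y u w) u v =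
            dir_deriv y u (christoffel (first_form G y) u v w) + h *\<^sub>R (snd (y u) *\<^sub>R e u))"

definition mean_curvature ::
    "((real ^ 'n) \<times> real) metric \<Rightarrow> (real ^ 'n \<Rightarrow> (real ^ 'n) \<times> real) \<Rightarrow>
     (real ^ 'n \<Rightarrow> (real ^ 'n) \<times> real) \<Rightarrow> real ^ 'n \<Rightarrow> real"
  where "mean_curvature G y e u =
    metric_trace (first_form G y u) (second_form G y e u) / real CARD('n)"

definition third_form ::
    "((real ^ 'n) \<times> real) metric \<Rightarrow> (real ^ 'n \<Rightarrow> (real ^ 'n) \<times> real) \<Rightarrow>
     (real ^ 'n \<Rightarrow> (real ^ 'n) \<times> real) \<Rightarrow> real ^ 'n \<Rightarrow> real ^ 'n \<Rightarrow> real ^ 'n \<Rightarrow> real"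
  where "third_form G y e u v w =
    (\<Sum>k\<in>UNIV. \<Sum>l\<in>UNIV. inverse_metric (first_form G y u) $ k $ l
        * second_form G y e u v (axis k 1) * second_form G y e u w (axis l 1))"

text \<open>\<open>B\<close> is the scalar product of the space containing the image of the normal Gauss map.\<close>

definition fourth_form ::
    "((real ^ 'n) \<times> real \<Rightarrow> (real ^ 'n) \<times> real \<Rightarrow> real) \<Rightarrow>
     (real ^ 'n \<Rightarrow> (real ^ 'n) \<times> real) \<Rightarrow> real ^ 'n \<Rightarrow> real ^ 'n \<Rightarrow> real ^ 'n \<Rightarrow> real"
  where "fourth_form B e u v w = B (dir_deriv e u v) (dir_deriv e u w)"

definition immersed_hypersurface ::
    "('m, real ^ 'n) chart set \<Rightarrow> ('m \<Rightarrow> (real ^ 'n) \<times> real) \<Rightarrow> bool"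
  where "immersed_hypersurface \<A> x \<longleftrightarrow> immersion \<A> x \<and> range x \<subseteq> upper_half_space"

definition spacelike ::
    "((real ^ 'n) \<times> real) metric \<Rightarrow> ('m, real ^ 'n) chart set \<Rightarrow> ('m \<Rightarrow> (real ^ 'n) \<times> real) \<Rightarrow> bool"
  where "spacelike G \<A> x \<longleftrightarrow>
    (\<forall>(V, \<phi>)\<in>\<A>. \<forall>u\<in>\<phi> ` V. \<forall>v. v \<noteq> 0 \<longrightarrow> first_form G (in_chart (V, \<phi>) x) u v v > 0)"

text \<open>\<open>\<eta>\<close> is the normal Gauss map of \<open>x\<close> belonging to the smooth normal field \<open>N = x\<^sub>n\<^sub>+\<^sub>1 \<eta>\<close>
  with \<open>G(N, N) = \<epsilon>\<close>. The type of \<open>\<eta>\<close> identifies the tangent spaces of the half-space with \<open>R\<^sup>n\<^sup>+\<^sup>1\<close>.\<close>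

definition normal_gauss_map ::
    "((real ^ 'n) \<times> real) metric \<Rightarrow> real \<Rightarrow> ('m, real ^ 'n) chart set \<Rightarrow>
     ('m \<Rightarrow> (real ^ 'n) \<times> real) \<Rightarrow> ('m \<Rightarrow> (real ^ 'n) \<times> real) \<Rightarrow> bool"
  where "normal_gauss_map G \<epsilon> \<A> x \<eta> \<longleftrightarrow>
    smooth_map \<A> \<eta> \<and>
    (\<forall>p. G (x p) (snd (x p) *\<^sub>R \<eta> p) (snd (x p) *\<^sub>R \<eta> p) = \<epsilon>) \<and>
    (\<forall>(V, \<phi>)\<in>\<A>. \<forall>p\<in>V. \<forall>v.
       G (x p) (dir_deriv (in_chart (V, \<phi>) x) (\<phi> p) v) (snd (x p) *\<^sub>R \<eta> p) = 0)"

end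

theory Submission
  imports Defs
begin

text \<open>Both metrics have the form \<open>B / x\<^sub>n\<^sub>+\<^sub>1\<^sup>2\<close> with the constant scalar product
  \<open>B = dx\<^sub>1\<^sup>2 + \<dots> + dx\<^sub>n\<^sup>2 + \<sigma> dx\<^sub>n\<^sub>+\<^sub>1\<^sup>2\<close>, where \<open>\<sigma> = 1\<close> or \<open>\<sigma> = - 1\<close>, have constant
  curvature \<open>- \<sigma>\<close>, and the normal satisfies \<open>B(\<eta>, \<eta>) = \<sigma>\<close>, so the two cases are treated together.
  Differentiating \<open>B(\<eta>, dx) = 0\<close> and inserting the explicit Christoffel symbols gives the Weingarten formula
  \<open>d\<eta> = dx \<circ> (\<eta>\<^sub>n\<^sub>+\<^sub>1 - \<sigma> A) / x\<^sub>n\<^sub>+\<^sub>1\<close> with the shape operator \<open>A\<close>. Squaring it yields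
  \<open>IV = \<eta>\<^sub>n\<^sub>+\<^sub>1\<^sup>2 I - 2 \<sigma> \<eta>\<^sub>n\<^sub>+\<^sub>1 II + III\<close>, and the trace of the Gauss equation gives \<open>III\<close> in terms of
  the Ricci form.\<close>

subsection \<open>Directional derivatives\<close>

lemma dir_deriv_eq:
  assumes "(f has_derivative f') (at u)"
  shows "dir_deriv f u v = f' v"
  using frechet_derivative_at[OF assms] by (simp add: dir_deriv_def)

lemma has_derivative_dir_deriv:
  assumes "f differentiable (at u)"
  shows "(f has_derivative dir_deriv f u) (at u)"
  using assms by (simp add: frechet_derivative_works dir_deriv_def[abs_def])

lemma linear_dir_deriv:
  assumes "f differentiable (at u)"
  shows "linear (dir_deriv f u)"
  using has_derivative_dir_deriv[OF assms] by (rule has_derivative_linear)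

section \<open>Symmetry of second directional derivatives\<close>

lemma has_real_derivative_along_line:
  fixes f :: "'a::real_normed_vector \<Rightarrow> real"
  assumes "f differentiable (at (c + s *\<^sub>R v))"
  shows "((\<lambda>s. f (c + s *\<^sub>R v)) has_real_derivative dir_deriv f (c + s *\<^sub>R v) v) (at s)"
proof -
  have "((\<lambda>s. f (c + s *\<^sub>R v)) has_derivative (\<lambda>h. dir_deriv f (c + s *\<^sub>R v) (h *\<^sub>R v))) (at s)"
    by (rule has_derivative_compose[where f = "\<lambda>s. c + s *\<^sub>R v", OF _ has_derivative_dir_deriv[OF assms]])
      (auto intro!: derivative_eq_intros)
  moreover have "dir_deriv f (c + s *\<^sub>R v) (h *\<^sub>R v) = dir_deriv f (c + s *\<^sub>R v) v * h" for h
    by (simp add: linear_cmul[OF linear_dir_deriv[OF assms]])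
  ultimately show ?thesis
    by (simp add: has_field_derivative_def mult_commute_abs)
qed

text \<open>Two uses of the one-variable mean value theorem, first along \<open>v\<close> and then
  along \<open>w\<close>. Exchanging \<open>v\<close> and \<open>w\<close> keeps the second
  difference and exchanges the two mixed derivatives.\<close>

lemma second_difference_mean_value:
  fixes f :: "'a::real_normed_vector \<Rightarrow> real"
  assumes "t > 0"
    and f: "\<And>q. q \<in> U \<Longrightarrow> f differentiable (at q)"
    and fv: "\<And>q. q \<in> U \<Longrightarrow> (\<lambda>q. dir_deriv f q v) differentiable (at q)"
    and U: "\<And>a b. 0 \<le> a \<Longrightarrow> a \<le> t \<Longrightarrow> 0 \<le> b \<Longrightarrow> b \<le> t \<Longrightarrow> u + a *\<^sub>R v + b *\<^sub>R w \<in> U"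
  obtains a b where "0 < a" "a < t" "0 < b" "b < t"
    and "f (u + t *\<^sub>R v + t *\<^sub>R w) - f (u + t *\<^sub>R v) - f (u + t *\<^sub>R w) + f u
      = t * t * dir_deriv (\<lambda>q. dir_deriv f q v) (u + a *\<^sub>R v + b *\<^sub>R w) w"
proof -
  \<comment> \<open>The second difference is the increment of \<open>?g\<close> over the interval
    from 0 to \<open>t\<close>.\<close>
  let ?g = "\<lambda>s. f (u + t *\<^sub>R w + s *\<^sub>R v) - f (u + s *\<^sub>R v)"
  have U1: "u + t *\<^sub>R w + s *\<^sub>R v \<in> U" "u + s *\<^sub>R v \<in> U" if "0 \<le> s" "s \<le> t" for s
    using U[of s t] U[of s 0] that \<open>t > 0\<close> by (auto simp: algebra_simps)
  obtain a where a: "0 < a" "a < t"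
    and ga: "?g t - ?g 0 = (t - 0) *
      (dir_deriv f (u + t *\<^sub>R w + a *\<^sub>R v) v - dir_deriv f (u + a *\<^sub>R v) v)"
    using MVT2[OF \<open>t > 0\<close>, of ?g
        "\<lambda>s. dir_deriv f (u + t *\<^sub>R w + s *\<^sub>R v) v - dir_deriv f (u + s *\<^sub>R v) v"]
      DERIV_diff[OF has_real_derivative_along_line[OF f] has_real_derivative_along_line[OF f]] U1
    by blast
  let ?k = "\<lambda>s. dir_deriv f (u + a *\<^sub>R v + s *\<^sub>R w) v"
  have "u + a *\<^sub>R v + s *\<^sub>R w \<in> U" if "0 \<le> s" "s \<le> t" for s
    using U[of a s] that a by auto
  then obtain b where b: "0 < b" "b < t"
    and kb: "?k t - ?k 0 = (t - 0) * dir_deriv (\<lambda>q. dir_deriv f q v) (u + a *\<^sub>R v + b *\<^sub>R w) w"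
    using MVT2[OF \<open>t > 0\<close>, of ?k
        "\<lambda>s. dir_deriv (\<lambda>q. dir_deriv f q v) (u + a *\<^sub>R v + s *\<^sub>R w) w"]
      has_real_derivative_along_line[OF fv] by blast
  have "f (u + t *\<^sub>R v + t *\<^sub>R w) - f (u + t *\<^sub>R v) - f (u + t *\<^sub>R w) + f u = ?g t - ?g 0"
    by (simp add: algebra_simps)
  also have "\<dots> = t * (?k t - ?k 0)"
    unfolding ga by (simp add: add_ac)
  also have "\<dots> = t * t * dir_deriv (\<lambda>q. dir_deriv f q v) (u + a *\<^sub>R v + b *\<^sub>R w) w"
    unfolding kb by simp
  finally show ?thesis
    using that a b by blast
qed

text \<open>The second difference is symmetric in \<open>v\<close> and \<open>w\<close>, so both
  mixed derivatives attain one common value at points arbitrarily close to \<open>u\<close>.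
  Continuity then forces equality at \<open>u\<close>.\<close>

lemma dir_deriv_commute_real:
  fixes f :: "'a::real_normed_vector \<Rightarrow> real"
  assumes "open U" "u \<in> U" "Ck_on 2 U f"
  shows "dir_deriv (\<lambda>q. dir_deriv f q v) u w = dir_deriv (\<lambda>q. dir_deriv f q w) u v" (is "?vw u = ?wv u")
proof -
  have f: "f differentiable (at q)" "(\<lambda>q. dir_deriv f q z) differentiable (at q)" if "q \<in> U" for q z
    using assms(3) that by (auto simp: numeral_2_eq_2)
  have "continuous_on U (\<lambda>q. dir_deriv (\<lambda>q. dir_deriv f q z) q z')" for z z'
    using assms(3) by (auto simp: numeral_2_eq_2)
  then have "isCont (\<lambda>q. dir_deriv (\<lambda>q. dir_deriv f q z) q z') u" for z z'
    using assms by (metis continuous_on_eq_continuous_at)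
  then have cont: "((\<lambda>q. dir_deriv (\<lambda>q. dir_deriv f q z) q z')
      \<longlongrightarrow> dir_deriv (\<lambda>q. dir_deriv f q z) u z') (nhds u)" for z z'
    using tendsto_at_iff_tendsto_nhds[of "\<lambda>q. dir_deriv (\<lambda>q. dir_deriv f q z) q z'" u]
    by (simp add: isCont_def)
  have "\<bar>?vw u - ?wv u\<bar> < e" if "e > 0" for e
  proof -
    have "\<forall>\<^sub>F q in nhds u. dist (?vw q) (?vw u) < e/2"
      using cont \<open>e > 0\<close>
      by (intro tendstoD) auto
    moreover have "\<forall>\<^sub>F q in nhds u. dist (?wv q) (?wv u) < e/2"
      using cont \<open>e > 0\<close>
      by (intro tendstoD) auto
    ultimately have "\<forall>\<^sub>F q in nhds u. q \<in> U \<and> dist (?vw q) (?vw u) < e/2 \<and> dist (?wv q) (?wv u) < e/2"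
      using assms by (auto intro!: eventually_conj eventually_nhds_in_open)
    then obtain d where d: "d > 0" and
      near: "\<And>q. dist q u < d \<Longrightarrow> q \<in> U \<and> dist (?vw q) (?vw u) < e/2 \<and> dist (?wv q) (?wv u) < e/2"
      unfolding eventually_nhds_metric by blast
    \<comment> \<open>With this side length the whole parallelogram spanned at \<open>u\<close> lies
      in the ball of radius \<open>d\<close>. The summand 1 keeps the denominator positive even for
      \<open>v = w = 0\<close>.\<close>
    define t where "t = d / (norm v + norm w + 1)"
    have pos: "norm v + norm w + 1 > 0"
      by (simp add: add_nonneg_pos)
    then have "t > 0"
      using \<open>d > 0\<close> by (simp add: t_def)
    have box: "dist (u + a *\<^sub>R v + b *\<^sub>R w) u < d" if "0 \<le> a" "a \<le> t" "0 \<le> b" "b \<le> t" for a b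
    proof -
      have "dist (u + a *\<^sub>R v + b *\<^sub>R w) u \<le> a * norm v + b * norm w"
        using norm_triangle_ineq[of "a *\<^sub>R v" "b *\<^sub>R w"] that by (simp add: dist_norm)
      also have "\<dots> \<le> t * norm v + t * norm w"
        using that by (intro add_mono mult_right_mono) auto
      also have "\<dots> < t * (norm v + norm w + 1)"
        using \<open>t > 0\<close> by (simp add: algebra_simps)
      also have "\<dots> = d"
        using pos by (simp add: t_def)
      finally show ?thesis .
    qed
    have box': "dist (u + a *\<^sub>R w + b *\<^sub>R v) u < d" if "0 \<le> a" "a \<le> t" "0 \<le> b" "b \<le> t" for a b
      using box[of b a] that by (simp add: add_ac)
    obtain a b where ab: "0 < a" "a < t" "0 < b" "b < t"
      "f (u + t *\<^sub>R v + t *\<^sub>R w) - f (u + t *\<^sub>R v) - f (u + t *\<^sub>R w) + f u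
        = t * t * ?vw (u + a *\<^sub>R v + b *\<^sub>R w)"
      by (rule second_difference_mean_value[OF \<open>t > 0\<close> f, where U = U and u = u and v = v and w = w]) (use box near in auto)
    obtain a' b' where ab': "0 < a'" "a' < t" "0 < b'" "b' < t"
      "f (u + t *\<^sub>R w + t *\<^sub>R v) - f (u + t *\<^sub>R w) - f (u + t *\<^sub>R v) + f u
        = t * t * ?wv (u + a' *\<^sub>R w + b' *\<^sub>R v)"
      by (rule second_difference_mean_value[OF \<open>t > 0\<close> f, where U = U and u = u and v = w and w = v]) (use box' near in auto)
    have swap: "u + t *\<^sub>R w + t *\<^sub>R v = u + t *\<^sub>R v + t *\<^sub>R w"
      by simp
    have "t * t * ?vw (u + a *\<^sub>R v + b *\<^sub>R w) = t * t * ?wv (u + a' *\<^sub>R w + b' *\<^sub>R v)"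
      using ab(5) ab'(5)[unfolded swap] by linarith
    then have "?vw (u + a *\<^sub>R v + b *\<^sub>R w) = ?wv (u + a' *\<^sub>R w + b' *\<^sub>R v)"
      using \<open>t > 0\<close> by simp
    moreover have "dist (?vw (u + a *\<^sub>R v + b *\<^sub>R w)) (?vw u) < e/2"
      "dist (?wv (u + a' *\<^sub>R w + b' *\<^sub>R v)) (?wv u) < e/2"
      using near box[of a b] box'[of a' b'] ab ab' by auto
    ultimately show ?thesis
      unfolding dist_real_def by linarith
  qed
  then show ?thesis
    by (metis abs_0_eq abs_ge_zero eq_iff_diff_eq_0 less_irrefl order_less_le)
qed

lemma dir_deriv_inner_left:
  assumes "f differentiable (at u)"
  shows "dir_deriv (\<lambda>q. f q \<bullet> b) u v = dir_deriv f u v \<bullet> b"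
  by (rule dir_deriv_eq) (auto intro!: derivative_eq_intros has_derivative_dir_deriv[OF assms])

lemma dir_deriv_commute:
  fixes f :: "'a::real_normed_vector \<Rightarrow> 'b::euclidean_space"
  assumes "open U" "u \<in> U" "Ck_on 2 U f"
  shows "dir_deriv (\<lambda>q. dir_deriv f q v) u w = dir_deriv (\<lambda>q. dir_deriv f q w) u v"
proof (rule euclidean_eqI)
  fix b :: 'b
  have f: "f differentiable (at q)" "(\<lambda>q. dir_deriv f q z) differentiable (at q)" if "q \<in> U" for q z
    using assms(3) that by (auto simp: numeral_2_eq_2)
  have fb: "dir_deriv (\<lambda>q. dir_deriv (\<lambda>q. f q \<bullet> b) q z) q z' = dir_deriv (\<lambda>q. dir_deriv f q z) q z' \<bullet> b"
    "(\<lambda>q. dir_deriv (\<lambda>q. f q \<bullet> b) q z) differentiable (at q)" if "q \<in> U" for q z z'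
  proof -
    have 1: "((\<lambda>q. dir_deriv f q z \<bullet> b) has_derivative (\<lambda>x. dir_deriv (\<lambda>q. dir_deriv f q z) q x \<bullet> b)) (at q)"
      by (auto intro!: derivative_eq_intros has_derivative_dir_deriv f that)
    have 2: "((\<lambda>q. dir_deriv (\<lambda>q. f q \<bullet> b) q z) has_derivative (\<lambda>x. dir_deriv (\<lambda>q. dir_deriv f q z) q x \<bullet> b)) (at q)"
      by (rule has_derivative_transform_within_open[OF 1 \<open>open U\<close> that]) (simp add: dir_deriv_inner_left f)
    show "dir_deriv (\<lambda>q. dir_deriv (\<lambda>q. f q \<bullet> b) q z) q z' = dir_deriv (\<lambda>q. dir_deriv f q z) q z' \<bullet> b"
      by (rule dir_deriv_eq[OF 2])
    show "(\<lambda>q. dir_deriv (\<lambda>q. f q \<bullet> b) q z) differentiable (at q)"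
      using 2 by (auto simp: differentiable_def)
  qed
  have "Ck_on 2 U (\<lambda>q. f q \<bullet> b)"
    using assms(3) f fb
    by (auto simp: numeral_2_eq_2 differentiable_inner cong: continuous_on_cong intro!: continuous_intros)
  from dir_deriv_commute_real[OF assms(1,2) this, of v w]
  show "dir_deriv (\<lambda>q. dir_deriv f q v) u w \<bullet> b = dir_deriv (\<lambda>q. dir_deriv f q w) u v \<bullet> b"
    by (simp add: fb assms)
qed

lemma smooth_on_imp_Ck_on: "smooth_on U f \<Longrightarrow> Ck_on k U f"
  by (simp add: smooth_on_def)

lemma smooth_on_imp_differentiable:
  assumes "smooth_on U f" and "u \<in> U"
  shows "f differentiable (at u)"
  using smooth_on_imp_Ck_on[OF assms(1), of "Suc 0"] assms(2) by simp

lemma smooth_on_dir_deriv: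
  assumes "smooth_on U f"
  shows "smooth_on U (\<lambda>u. dir_deriv f u v)"
  unfolding smooth_on_def using smooth_on_imp_Ck_on[OF assms, of "Suc k" for k] by simp


subsection \<open>Scalar products\<close>

lemma sum_Basis_axis:
  fixes f :: "real ^ 'n \<Rightarrow> 'b::comm_monoid_add"
  shows "(\<Sum>b\<in>Basis. f b) = (\<Sum>i\<in>UNIV. f (axis i (1::real)))"
proof -
  have "(Basis :: (real ^ 'n) set) = range (\<lambda>i. axis i 1)"
    by (auto simp: Basis_vec_def)
  moreover have "sum f (range (\<lambda>i::'n. axis i (1::real))) = (\<Sum>i\<in>UNIV. f (axis i 1))"
    by (subst sum.reindex) (auto simp: inj_on_def axis_eq_axis)
  ultimately show ?thesis
    by argo
qed

lemma linear_axis_expansion: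
  fixes f :: "real ^ 'n \<Rightarrow> 'b::real_vector"
  assumes "linear f"
  shows "f z = (\<Sum>i\<in>UNIV. (z $ i) *\<^sub>R f (axis i 1))"
proof -
  have "f z = f (\<Sum>i\<in>UNIV. (z $ i) *\<^sub>R axis i 1)"
    using basis_expansion[of z] by (simp add: scalar_mult_eq_scaleR)
  then show ?thesis
    by (simp add: linear_sum[OF assms] linear_cmul[OF assms])
qed

lemma differentiable_prod:
  fixes f :: "'i \<Rightarrow> 'a::real_normed_vector \<Rightarrow> real"
  assumes "finite S" and "\<And>i. i \<in> S \<Longrightarrow> f i differentiable (at u)"
  shows "(\<lambda>q. \<Prod>i\<in>S. f i q) differentiable (at u)"
  using assms by (induction rule: finite_induct) (auto intro!: differentiable_mult)

lemma differentiable_det: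
  fixes A :: "'a::real_normed_vector \<Rightarrow> real ^ 'n ^ 'n"
  assumes "\<And>i j. (\<lambda>q. A q $ i $ j) differentiable (at u)"
  shows "(\<lambda>q. det (A q)) differentiable (at u)"
proof -
  have "(\<lambda>q. \<Prod>i\<in>UNIV. A q $ i $ p i) differentiable (at u)" for p
    using assms by (intro differentiable_prod) auto
  then show ?thesis
    unfolding det_def by (intro differentiable_sum differentiable_mult) auto
qed

section \<open>Gram matrices and raising an index\<close>

definition gram :: "(real ^ 'n \<Rightarrow> real ^ 'n \<Rightarrow> real) \<Rightarrow> real ^ 'n ^ 'n"
  where "gram g = (\<chi> i j. g (axis i 1) (axis j 1))"

locale scalar_product =
  fixes g :: "real ^ 'n \<Rightarrow> real ^ 'n \<Rightarrow> real"
  assumes bilinear: "bilinear g"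
    and sym: "g v w = g w v"
    and pos: "v \<noteq> 0 \<Longrightarrow> g v v > 0"
begin

lemma nondegenerate:
  assumes "\<And>z. g v z = g w z"
  shows "v = w"
proof -
  have "g (v - w) (v - w) = 0"
    using assms by (simp add: bilinear_lsub[OF bilinear])
  then show ?thesis
    using pos[of "v - w"] by force
qed

lemma eq_inner_gram: "g v w = (gram g *v v) \<bullet> w"
proof -
  have "linear (g v)" "linear (\<lambda>v. g v z)" for z
    using bilinear by (auto simp: bilinear_def)
  then have "g v w = (\<Sum>j\<in>UNIV. w $ j * (\<Sum>i\<in>UNIV. v $ i * g (axis i 1) (axis j 1)))"
    using linear_axis_expansion[of "g v" w] linear_axis_expansion[of "\<lambda>v. g v (axis _ 1)" v] by simp
  then show ?thesis
    by (simp add: inner_vec_def matrix_vector_mult_def gram_def sym mult.commute)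
qed

text \<open>Nondegeneracy makes the Gram matrix injective, hence invertible, so the choice inside
  \<open>matrix_inv\<close> yields a genuine inverse.\<close>

lemma gram_inverse: "gram g ** inverse_metric g = mat 1"
proof -
  have "x = y" if "gram g *v x = gram g *v y" for x y
    using that by (intro nondegenerate) (simp add: eq_inner_gram)
  then have "invertible (gram g)"
    by (auto simp: invertible_left_inverse matrix_left_invertible_injective inj_def)
  then show ?thesis
    unfolding inverse_metric_def gram_def[symmetric] matrix_inv_def invertible_def by (rule someI2_ex) auto
qed

lemma det_gram: "det (gram g) \<noteq> 0"
  using gram_inverse by (metis invertible_det_nz invertible_right_inverse)

end

text \<open>The musical isomorphism from covectors to vectors. It yields both the Christoffel
  symbols of the induced metric and the shape operator.\<close>

definition sharp :: "(real ^ 'n \<Rightarrow> real ^ 'n \<Rightarrow> real) \<Rightarrow> (real ^ 'n \<Rightarrow> real) \<Rightarrow> real ^ 'n"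
  where "sharp g b = inverse_metric g *v (\<chi> l. b (axis l 1))"

lemma sharp_nth: "sharp g b $ k = (\<Sum>l\<in>UNIV. inverse_metric g $ k $ l * b (axis l 1))"
  by (simp add: sharp_def matrix_vector_mult_def)

lemma (in scalar_product) gram_sharp: "gram g *v sharp g b = (\<chi> l. b (axis l 1))"
  unfolding sharp_def matrix_vector_mul_assoc gram_inverse by simp

lemma (in scalar_product) sharp:
  assumes "linear b"
  shows "g (sharp g b) z = b z"
  unfolding eq_inner_gram gram_sharp
  by (subst (2) linear_axis_expansion[OF assms]) (simp add: inner_vec_def mult.commute)

text \<open>The metric trace of a form is the ordinary trace of the endomorphism obtained by raising
  an index. This is the shape in which it arises from the sum in \<open>ricci\<close>.\<close>

lemma metric_trace_eq: "metric_trace g h = (\<Sum>b\<in>Basis. sharp g (h b) \<bullet> b)"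
  by (simp add: metric_trace_def sum_Basis_axis inner_axis sharp_nth)

lemma sum_inverse_metric_eq:
  assumes "linear a"
  shows "(\<Sum>k\<in>UNIV. \<Sum>l\<in>UNIV. inverse_metric g $ k $ l * a (axis k 1) * b (axis l 1)) = a (sharp g b)"
  by (subst linear_axis_expansion[OF assms])
    (simp add: sharp_nth sum_distrib_right sum_distrib_left mult_ac)

lemma sum_Basis_inner_linear:
  fixes x :: "'a::euclidean_space" and f :: "'a \<Rightarrow> real"
  assumes "linear f"
  shows "(\<Sum>b\<in>Basis. f b * (x \<bullet> b)) = f x"
proof -
  have "f x = f (\<Sum>b\<in>Basis. (x \<bullet> b) *\<^sub>R b)"
    by (simp add: euclidean_representation)
  then show ?thesis
    by (simp add: linear_sum[OF assms] linear_cmul[OF assms] mult.commute)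
qed

text \<open>By Cramer's rule the solution of a linear system depends differentiably on its coefficients.\<close>

lemma differentiable_sharp:
  fixes g :: "'a::real_normed_vector \<Rightarrow> real ^ 'n \<Rightarrow> real ^ 'n \<Rightarrow> real"
  assumes "open U" "u \<in> U"
    and g: "\<And>q. q \<in> U \<Longrightarrow> scalar_product (g q)"
    and dg: "\<And>v w. (\<lambda>q. g q v w) differentiable (at u)"
    and db: "\<And>v. (\<lambda>q. b q v) differentiable (at u)"
  shows "(\<lambda>q. sharp (g q) (b q)) differentiable (at u)"
proof -
  let ?M = "\<lambda>q. gram (g q)"
  \<comment> \<open>The Gram matrix with column \<open>k\<close> replaced by the right-hand side, as
    in Cramer's rule. In \<open>?c\<close> the solution is a finite sum of scalar multiples, so that
    the differentiation rules for sums apply.\<close>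
  let ?N = "\<lambda>k q. \<chi> i j. if j = k then b q (axis i 1) else g q (axis i 1) (axis j 1)"
  let ?c = "\<lambda>q. \<Sum>k\<in>UNIV. (det (?N k q) / det (?M q)) *\<^sub>R axis k 1 :: real ^ 'n"
  have c: "sharp (g q) (b q) = ?c q" if "q \<in> U" for q
  proof -
    have *: "?N k q = (\<chi> i j. if j = k then (\<chi> l. b q (axis l 1)) $ i else ?M q $ i $ j)" for k
      by (simp add: vec_eq_iff gram_def)
    have "sharp (g q) (b q) = (\<chi> k. det (?N k q) / det (?M q))"
      unfolding * by (rule cramer[THEN iffD1])
        (use scalar_product.det_gram scalar_product.gram_sharp g that in blast)+
    also have "\<dots> = ?c q"
      using basis_expansion[of "\<chi> k. det (?N k q) / det (?M q)"]
      by (simp add: scalar_mult_eq_scaleR)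
    finally show ?thesis .
  qed
  have "(\<lambda>q. ?M q $ i $ j) differentiable (at u)" for i j
    by (simp add: dg gram_def)
  then have "(\<lambda>q. det (?M q)) differentiable (at u)"
    by (rule differentiable_det)
  moreover have "(\<lambda>q. det (?N k q)) differentiable (at u)" for k
  proof (rule differentiable_det)
    show "(\<lambda>q. ?N k q $ i $ j) differentiable (at u)" for i j
      by (cases "j = k") (simp_all add: dg db)
  qed
  moreover have "det (?M u) \<noteq> 0"
    using g[OF \<open>u \<in> U\<close>] by (rule scalar_product.det_gram)
  ultimately have "?c differentiable (at u)"
    by (intro differentiable_sum differentiable_scaleR differentiable_divide differentiable_const) auto
  then obtain D where "(?c has_derivative D) (at u)"
    by (auto simp: differentiable_def)
  then have "((\<lambda>q. sharp (g q) (b q)) has_derivative D) (at u)"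
    by (rule has_derivative_transform_within_open[OF _ assms(1,2)]) (simp add: c)
  then show ?thesis
    by (auto simp: differentiable_def)
qed


subsection \<open>The metrics of the half-space\<close>

definition half_form :: "real \<Rightarrow> (real ^ 'n) \<times> real \<Rightarrow> (real ^ 'n) \<times> real \<Rightarrow> real"
  where "half_form \<sigma> v w = fst v \<bullet> fst w + \<sigma> * (snd v * snd w)"

definition half_space_metric :: "real \<Rightarrow> ((real ^ 'n) \<times> real) metric"
  where "half_space_metric \<sigma> p v w = half_form \<sigma> v w / (snd p)\<^sup>2"

lemma half_form_one: "half_form 1 = (\<bullet>)"
  by (simp add: half_form_def inner_prod_def fun_eq_iff)

lemma half_form_minus_one: "half_form (- 1) = lorentz"
  by (simp add: half_form_def lorentz_def fun_eq_iff)

lemma half_space_metric_one: "half_space_metric 1 = hyperbolic_metric"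
  by (simp add: half_space_metric_def hyperbolic_metric_def half_form_one fun_eq_iff)

lemma half_space_metric_minus_one: "half_space_metric (- 1) = de_sitter_metric"
  by (simp add: half_space_metric_def de_sitter_metric_def half_form_minus_one fun_eq_iff)

lemma half_form_commute: "half_form \<sigma> v w = half_form \<sigma> w v"
  by (simp add: half_form_def inner_commute mult.commute)

lemma bounded_bilinear_half_form: "bounded_bilinear (half_form \<sigma>)"
  unfolding bilinear_conv_bounded_bilinear[symmetric] bilinear_def half_form_def
  by (auto intro!: linearI simp: inner_add_left inner_add_right algebra_simps)

interpretation half_form: bounded_bilinear "half_form \<sigma>"
  by (rule bounded_bilinear_half_form)

lemmas half_form_linear [simp] =
  half_form.add_left half_form.add_right half_form.diff_left half_form.diff_right
  half_form.scaleR_left half_form.scaleR_right half_form.minus_left half_form.minus_right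

lemma half_form_snd [simp]:
  "half_form \<sigma> v (0, r) = \<sigma> * (snd v * r)" "half_form \<sigma> (0, r) v = \<sigma> * (r * snd v)"
  by (simp_all add: half_form_def)

lemma half_form_nondegenerate:
  assumes "\<sigma> * \<sigma> = 1" and "\<And>z. half_form \<sigma> v z = half_form \<sigma> w z"
  shows "v = w"
proof -
  have "\<sigma> \<noteq> 0"
    using assms(1) by auto
  then have "snd v = snd w"
    using assms(2)[of "(0, 1)"] by simp
  moreover have "fst v \<bullet> z = fst w \<bullet> z" for z
    using assms(2)[of "(z, 0)"] by (simp add: half_form_def)
  then have "fst v = fst w"
    using vector_eq_rdot by blast
  ultimately show ?thesis
    by (simp add: prod_eq_iff)
qed

text \<open>The Christoffel symbols of a conformally flat metric: with
  \<open>f = - ln (snd p)\<close> they are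
  \<open>df a *\<^sub>R b + df b *\<^sub>R a - B a b *\<^sub>R grad f\<close>. The gradient is taken
  with respect to \<open>B\<close>, and \<sigma> enters through it.\<close>

definition half_space_conn ::
    "real \<Rightarrow> (real ^ 'n) \<times> real \<Rightarrow> (real ^ 'n) \<times> real \<Rightarrow> (real ^ 'n) \<times> real \<Rightarrow> (real ^ 'n) \<times> real"
  where "half_space_conn \<sigma> p a b =
    - (1 / snd p) *\<^sub>R (snd a *\<^sub>R b + snd b *\<^sub>R a - (\<sigma> * half_form \<sigma> a b) *\<^sub>R (0, 1))"

lemma half_space_conn_add_left [simp]:
  "half_space_conn \<sigma> p (a + a') b = half_space_conn \<sigma> p a b + half_space_conn \<sigma> p a' b"
  by (simp add: half_space_conn_def algebra_simps)

lemma half_space_conn_commute: "half_space_conn \<sigma> p a b = half_space_conn \<sigma> p b a"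
  by (simp add: half_space_conn_def add.commute half_form_commute)

lemma half_space_conn_add_right [simp]:
  "half_space_conn \<sigma> p a (b + b') = half_space_conn \<sigma> p a b + half_space_conn \<sigma> p a b'"
  by (simp add: half_space_conn_commute[of _ _ a])

lemma half_space_conn_scaleR_left [simp]:
  "half_space_conn \<sigma> p (c *\<^sub>R a) b = c *\<^sub>R half_space_conn \<sigma> p a b"
  by (simp add: half_space_conn_def algebra_simps)

lemma half_space_conn_scaleR_right [simp]:
  "half_space_conn \<sigma> p a (c *\<^sub>R b) = c *\<^sub>R half_space_conn \<sigma> p a b"
  by (simp add: half_space_conn_commute[of _ _ a])

text \<open>Pairing \<open>(0, 1)\<close> with \<open>c\<close> produces a second factor \<sigma>,
  so \<sigma> disappears from the lowered Christoffel symbols.\<close>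

lemma half_form_half_space_conn:
  assumes "\<sigma> * \<sigma> = 1"
  shows "half_form \<sigma> (half_space_conn \<sigma> p a b) c =
    - (snd a * half_form \<sigma> b c + snd b * half_form \<sigma> a c - snd c * half_form \<sigma> a b) / snd p"
proof -
  have "\<sigma> = 1 \<or> \<sigma> = - 1"
    using assms by (simp add: square_eq_1_iff)
  then show ?thesis
    by (auto simp: half_space_conn_def diff_divide_distrib add_divide_distrib algebra_simps)
qed

lemma snd_half_space_conn:
  "snd (half_space_conn \<sigma> p a b) = - (2 * snd a * snd b - \<sigma> * half_form \<sigma> a b) / snd p"
  by (simp add: half_space_conn_def diff_divide_distrib algebra_simps)

text \<open>The left-hand side is the curvature tensor: the terms with \<open>snd a / snd p\<close> and \<open>snd b / snd p\<close> are
  the derivatives of the Christoffel symbols, which depend on \<open>p\<close> through the factor \<open>1 / snd p\<close> only.\<close>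

lemma half_space_conn_curvature:
  assumes "\<sigma> * \<sigma> = 1" and "snd p \<noteq> 0"
  shows "half_form \<sigma> (half_space_conn \<sigma> p a (half_space_conn \<sigma> p b c)
        - (snd a / snd p) *\<^sub>R half_space_conn \<sigma> p b c
        - half_space_conn \<sigma> p b (half_space_conn \<sigma> p a c)
        + (snd b / snd p) *\<^sub>R half_space_conn \<sigma> p a c) d =
    - \<sigma> * (half_form \<sigma> b c * half_form \<sigma> a d - half_form \<sigma> a c * half_form \<sigma> b d) / (snd p)\<^sup>2"
proof -
  \<comment> \<open>Connection terms are moved to the left slot, where
    \<open>half_form_half_space_conn\<close> evaluates them.\<close>
  have "half_form \<sigma> a (half_space_conn \<sigma> p b c) = half_form \<sigma> (half_space_conn \<sigma> p b c) a" for a b c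
    by (rule half_form_commute)
  moreover have "half_form \<sigma> c a = half_form \<sigma> a c" "half_form \<sigma> c b = half_form \<sigma> b c"
    "half_form \<sigma> b a = half_form \<sigma> a b"
    by (rule half_form_commute)+
  ultimately show ?thesis
    using assms(2)
    by (simp add: half_form_half_space_conn[OF assms(1)] snd_half_space_conn)
      (simp add: field_simps power2_eq_square)
qed

text \<open>The second premise is the nondegeneracy that makes the \<open>THE\<close> well defined.
  In this form it covers the indefinite ambient metric as well as the induced one.\<close>

lemma christoffel_eqI:
  assumes "\<And>z. 2 * G p c z =
      dir_deriv (\<lambda>q. G q w z) p v + dir_deriv (\<lambda>q. G q v z) p w - dir_deriv (\<lambda>q. G q v w) p z"
    and "\<And>d. (\<And>z. G p d z = G p c z) \<Longrightarrow> d = c"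
  shows "christoffel G p v w = c"
  unfolding christoffel_def
proof (rule the_equality)
  fix d
  assume "\<forall>z. 2 * G p d z =
      dir_deriv (\<lambda>q. G q w z) p v + dir_deriv (\<lambda>q. G q v z) p w - dir_deriv (\<lambda>q. G q v w) p z"
  then show "d = c"
    using assms(1) by (intro assms(2)) (metis mult_left_cancel zero_neq_numeral)
qed (use assms(1) in blast)

lemma christoffel_half_space_metric:
  assumes "\<sigma> * \<sigma> = 1" and p: "snd p \<noteq> 0"
  shows "christoffel (half_space_metric \<sigma>) p v w = half_space_conn \<sigma> p v w"
proof (rule christoffel_eqI)
  have d: "dir_deriv (\<lambda>q. half_space_metric \<sigma> q a b) p z = - 2 * snd z * half_form \<sigma> a b / snd p ^ 3"
    for a b z :: "(real ^ 'a) \<times> real"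
    unfolding half_space_metric_def
    by (rule dir_deriv_eq, rule has_derivative_eq_rhs)
      (use p in \<open>auto intro!: derivative_eq_intros simp: fun_eq_iff field_simps power2_eq_square power3_eq_cube\<close>)
  show "2 * half_space_metric \<sigma> p (half_space_conn \<sigma> p v w) z =
      dir_deriv (\<lambda>q. half_space_metric \<sigma> q w z) p v + dir_deriv (\<lambda>q. half_space_metric \<sigma> q v z) p w
      - dir_deriv (\<lambda>q. half_space_metric \<sigma> q v w) p z" for z
    unfolding d using p by (simp add: half_space_metric_def half_form_half_space_conn[OF assms(1)]
      field_simps power2_eq_square power3_eq_cube)
next
  fix d :: "(real ^ 'a) \<times> real"
  assume "\<And>z. half_space_metric \<sigma> p d z = half_space_metric \<sigma> p (half_space_conn \<sigma> p v w) z"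
  then show "d = half_space_conn \<sigma> p v w"
    using p by (intro half_form_nondegenerate[OF assms(1)]) (simp add: half_space_metric_def)
qed

text \<open>The product rule: the connection is bilinear in \<open>a\<close> and \<open>b\<close>,
  and the last term is the derivative of the factor \<open>- 1 / snd (y q)\<close>.\<close>

lemma has_derivative_half_space_conn:
  assumes y: "(y has_derivative y') (at u)" and a: "(a has_derivative a') (at u)"
    and b: "(b has_derivative b') (at u)" and nz: "snd (y u) \<noteq> 0"
  shows "((\<lambda>q. half_space_conn \<sigma> (y q) (a q) (b q)) has_derivative
    (\<lambda>v. half_space_conn \<sigma> (y u) (a' v) (b u) + half_space_conn \<sigma> (y u) (a u) (b' v)
      - (snd (y' v) / snd (y u)) *\<^sub>R half_space_conn \<sigma> (y u) (a u) (b u))) (at u)"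
proof -
  let ?X = "\<lambda>a b. snd a *\<^sub>R b + snd b *\<^sub>R a - (\<sigma> * half_form \<sigma> a b) *\<^sub>R (0, 1 :: real)"
  have "((\<lambda>q. ?X (a q) (b q)) has_derivative (\<lambda>v. ?X (a' v) (b u) + ?X (a u) (b' v))) (at u)"
    by (rule has_derivative_eq_rhs)
      (auto intro!: derivative_eq_intros half_form.FDERIV a b simp: fun_eq_iff algebra_simps)
  moreover have "((\<lambda>q. - (1 / snd (y q))) has_derivative (\<lambda>v. snd (y' v) / (snd (y u))\<^sup>2)) (at u)"
    by (rule has_derivative_eq_rhs)
      (use nz in \<open>auto intro!: derivative_eq_intros y simp: fun_eq_iff power2_eq_square\<close>)
  ultimately have "((\<lambda>q. - (1 / snd (y q)) *\<^sub>R ?X (a q) (b q)) has_derivative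
      (\<lambda>v. - (1 / snd (y u)) *\<^sub>R (?X (a' v) (b u) + ?X (a u) (b' v))
        + (snd (y' v) / (snd (y u))\<^sup>2) *\<^sub>R ?X (a u) (b u))) (at u)"
    by (rule has_derivative_scaleR[rotated])
  then show ?thesis
    unfolding half_space_conn_def
    by (rule has_derivative_eq_rhs) (simp add: fun_eq_iff scaleR_add_right power2_eq_square)
qed


subsection \<open>Hypersurfaces in the half-space\<close>

text \<open>The situation in a single chart, with the powers of the height cancelled so that the
  conditions concern \<open>B\<close> alone. For \<sigma> = 1 the condition \<open>form_pos\<close>
  expresses injectivity of the differential, for \<sigma> = - 1 that the hypersurface is
  space-like.\<close>

locale half_space_immersion =
  fixes \<sigma> :: real and U :: "(real ^ 'n) set" and y e :: "real ^ 'n \<Rightarrow> (real ^ 'n) \<times> real"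
  assumes sigma_square: "\<sigma> * \<sigma> = 1"
    and open_U: "open U"
    and smooth_y: "smooth_on U y"
    and smooth_e: "smooth_on U e"
    and height_pos: "u \<in> U \<Longrightarrow> snd (y u) > 0"
    and form_pos: "u \<in> U \<Longrightarrow> v \<noteq> 0 \<Longrightarrow> half_form \<sigma> (dir_deriv y u v) (dir_deriv y u v) > 0"
    and normal_unit: "u \<in> U \<Longrightarrow> half_form \<sigma> (e u) (e u) = \<sigma>"
    and normal: "u \<in> U \<Longrightarrow> half_form \<sigma> (dir_deriv y u v) (e u) = 0"
begin

abbreviation "B \<equiv> half_form \<sigma>"
abbreviation "conn \<equiv> half_space_conn \<sigma>"
abbreviation "L \<equiv> dir_deriv y"
abbreviation "I \<equiv> first_form (half_space_metric \<sigma>) y"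
abbreviation "h \<equiv> second_form (half_space_metric \<sigma>) y e"
abbreviation "\<Gamma> \<equiv> christoffel I"

definition L2 :: "real ^ 'n \<Rightarrow> real ^ 'n \<Rightarrow> real ^ 'n \<Rightarrow> (real ^ 'n) \<times> real"
  where "L2 u v w = dir_deriv (\<lambda>q. dir_deriv y q w) u v"

text \<open>The ambient covariant derivative \<open>D\<^sub>X Y\<close> along the immersion, where \<open>X\<close> and \<open>Y\<close> are the images of
  the fields with constant components \<open>v\<close> and \<open>w\<close>.\<close>

definition DL :: "real ^ 'n \<Rightarrow> real ^ 'n \<Rightarrow> real ^ 'n \<Rightarrow> (real ^ 'n) \<times> real"
  where "DL u v w = L2 u v w + conn (y u) (L u v) (L u w)"

lemma sigma_cancel [simp]: "\<sigma> * (\<sigma> * r) = r"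
  using sigma_square by (metis mult.assoc mult_1)

lemma first_form_eq: "I u v w = B (L u v) (L u w) / (snd (y u))\<^sup>2"
  by (simp add: first_form_def half_space_metric_def)

lemma half_form_tangent:
  assumes "u \<in> U"
  shows "B (L u v) (L u w) = (snd (y u))\<^sup>2 * I u v w"
  using height_pos[OF assms] by (simp add: first_form_eq)

lemma has_derivative_y: "u \<in> U \<Longrightarrow> (y has_derivative L u) (at u)"
  by (rule has_derivative_dir_deriv[OF smooth_on_imp_differentiable[OF smooth_y]])

lemma has_derivative_e: "u \<in> U \<Longrightarrow> (e has_derivative dir_deriv e u) (at u)"
  by (rule has_derivative_dir_deriv[OF smooth_on_imp_differentiable[OF smooth_e]])

lemma has_derivative_L: "u \<in> U \<Longrightarrow> ((\<lambda>q. L q w) has_derivative (\<lambda>v. L2 u v w)) (at u)"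
  unfolding L2_def
  by (rule has_derivative_dir_deriv[OF smooth_on_imp_differentiable[OF smooth_on_dir_deriv[OF smooth_y]]])

lemma has_derivative_L2:
  "u \<in> U \<Longrightarrow> ((\<lambda>q. L2 q v w) has_derivative dir_deriv (\<lambda>q. L2 q v w) u) (at u)"
  unfolding L2_def
  by (rule has_derivative_dir_deriv[OF smooth_on_imp_differentiable[OF
        smooth_on_dir_deriv[OF smooth_on_dir_deriv[OF smooth_y]]]])

lemma linear_L: "u \<in> U \<Longrightarrow> linear (L u)"
  by (rule has_derivative_linear[OF has_derivative_y])

lemma L2_commute: "u \<in> U \<Longrightarrow> L2 u v w = L2 u w v"
  unfolding L2_def using dir_deriv_commute[OF open_U] smooth_on_imp_Ck_on[OF smooth_y] by blast

text \<open>Linearity in the direction of differentiation is automatic; symmetry carries it over to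
  the other argument.\<close>

lemma linear_L2: "u \<in> U \<Longrightarrow> linear (L2 u v)"
  using has_derivative_linear[OF has_derivative_L[of u v]] L2_commute[of u v]
  by (simp add: ext[of "L2 u v" "\<lambda>w. L2 u w v"])

lemma L3_commute:
  "u \<in> U \<Longrightarrow> dir_deriv (\<lambda>q. L2 q w z) u v = dir_deriv (\<lambda>q. L2 q v z) u w"
  unfolding L2_def using dir_deriv_commute[OF open_U _ smooth_on_imp_Ck_on[OF smooth_on_dir_deriv[OF smooth_y]]] by blast

lemma DL_commute: "u \<in> U \<Longrightarrow> DL u v w = DL u w v"
  using L2_commute[of u v w] by (simp add: DL_def half_space_conn_commute)

lemma linear_DL: "u \<in> U \<Longrightarrow> linear (DL u v)"
  using linear_L[of u] linear_L2[of u v]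
  by (auto intro!: linearI simp: DL_def linear_add linear_cmul algebra_simps)

lemma scalar_product_first_form:
  assumes "u \<in> U"
  shows "scalar_product (I u)"
proof
  show "bilinear (I u)"
    using linear_L[OF assms]
    by (auto intro!: linearI simp: bilinear_def first_form_eq linear_add linear_cmul add_divide_distrib)
  show "I u v w = I u w v" for v w
    by (simp add: first_form_eq half_form_commute)
  show "I u v v > 0" if "v \<noteq> 0" for v
    using form_pos[OF assms that] height_pos[OF assms] by (simp add: first_form_eq)
qed

text \<open>The tangent vectors and \<open>e u\<close> span the ambient space: \<open>?T\<close> is
  injective, as pairing with \<open>e u\<close> shows, and acts between spaces of equal dimension.
  The coefficient follows from \<open>B (e u) (e u)\<close> = \<sigma>.\<close>

lemma normal_component:
  assumes "u \<in> U" and "\<And>z. B X (L u z) = 0"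
  shows "X = (\<sigma> * B X (e u)) *\<^sub>R e u"
proof -
  let ?T = "\<lambda>p. L u (fst p) + snd p *\<^sub>R e u"
  have lin: "linear ?T"
    using linear_L[OF assms(1)] by (auto intro!: linearI simp: linear_add linear_cmul algebra_simps)
  have "p = 0" if "?T p = 0" for p
  proof -
    have "B (?T p) (e u) = 0"
      unfolding that by (simp add: half_form.zero_left)
    then have "snd p = 0"
      using sigma_square by (auto simp: normal normal_unit assms(1))
    then have "L u (fst p) = 0"
      using that by simp
    then have "fst p = 0"
      using form_pos[OF assms(1), of "fst p"] by (auto simp: half_form.zero_left)
    with \<open>snd p = 0\<close> show ?thesis
      by (simp add: prod_eq_iff)
  qed
  then have "inj ?T"
    using linear_injective_0[OF lin] by blast
  then have "surj ?T"
    by (simp add: linear_injective_imp_surjective[OF lin])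
  then obtain p where p: "X = ?T p"
    by (rule surjE)
  have "B (L u (fst p)) (L u (fst p)) = 0"
    using assms(2)[of "fst p"] normal[OF assms(1), of "fst p"]
    by (simp add: p half_form_commute[of _ "e u"])
  then have "fst p = 0"
    using form_pos[OF assms(1), of "fst p"] by force
  then have X: "X = snd p *\<^sub>R e u"
    using linear_0[OF linear_L[OF assms(1)]] by (simp add: p)
  have "\<sigma> * B X (e u) = snd p"
    using sigma_square by (simp add: X normal_unit assms(1))
  with X show ?thesis
    by metis
qed

section \<open>The induced connection and the Gauss formula\<close>

lemma has_derivative_first_form:
  assumes "u \<in> U"
  shows "((\<lambda>q. I q w z) has_derivative
    (\<lambda>v. (B (L2 u v w) (L u z) + B (L u w) (L2 u v z)) / (snd (y u))\<^sup>2
      - 2 * snd (L u v) * B (L u w) (L u z) / snd (y u) ^ 3)) (at u)"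
proof -
  note 1 = half_form.FDERIV[OF has_derivative_L[OF assms, of w] has_derivative_L[OF assms, of z]]
  note 2 = has_derivative_snd[OF has_derivative_y[OF assms]]
  have "snd (y u) \<noteq> 0"
    using height_pos[OF assms] by simp
  then show ?thesis
    unfolding first_form_eq
    by (intro has_derivative_eq_rhs[OF has_derivative_divide[OF 1 has_derivative_power[OF 2]]])
      (auto simp: fun_eq_iff field_simps power2_eq_square power3_eq_cube)
qed

lemma linear_half_form_L: "u \<in> U \<Longrightarrow> linear (\<lambda>z. B X (L u z) / c)"
  using linear_L[of u] by (auto intro!: linearI simp: linear_add linear_cmul add_divide_distrib)

text \<open>In the Koszul formula the symmetry of \<open>L2\<close> leaves a single second
  derivative, and differentiating the height contributes the ambient connection. The induced
  connection is thus the tangential part of \<open>DL\<close>.\<close>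

lemma christoffel_first_form:
  assumes "u \<in> U"
  shows "\<Gamma> u v w = sharp (I u) (\<lambda>z. B (DL u v w) (L u z) / (snd (y u))\<^sup>2)"
proof (rule christoffel_eqI)
  interpret scalar_product "I u"
    by (rule scalar_product_first_form[OF assms])
  have nz: "snd (y u) \<noteq> 0"
    using height_pos[OF assms] by simp
  have d: "dir_deriv (\<lambda>q. I q w z) u v = (B (L2 u v w) (L u z) + B (L u w) (L2 u v z)) / (snd (y u))\<^sup>2
      - 2 * snd (L u v) * B (L u w) (L u z) / snd (y u) ^ 3" for v w z
    by (rule dir_deriv_eq[OF has_derivative_first_form[OF assms]])
  show "2 * I u (sharp (I u) (\<lambda>z. B (DL u v w) (L u z) / (snd (y u))\<^sup>2)) z =
      dir_deriv (\<lambda>q. I q w z) u v + dir_deriv (\<lambda>q. I q v z) u w - dir_deriv (\<lambda>q. I q v w) u z" for z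
  proof -
    have c: "L2 u z v = L2 u v z" "L2 u z w = L2 u w z" "L2 u w v = L2 u v w"
      by (rule L2_commute[OF assms])+
    have c': "B (L u w) (L2 u v z) = B (L2 u v z) (L u w)"
      by (rule half_form_commute)
    show ?thesis
      unfolding sharp[OF linear_half_form_L[OF assms]] d c c'
      using nz by (simp add: DL_def half_form_half_space_conn[OF sigma_square] field_simps
        power2_eq_square power3_eq_cube)
  qed
  show "d = sharp (I u) (\<lambda>z. B (DL u v w) (L u z) / (snd (y u))\<^sup>2)"
    if "\<And>z. I u d z = I u (sharp (I u) (\<lambda>z. B (DL u v w) (L u z) / (snd (y u))\<^sup>2)) z" for d
    using that by (rule nondegenerate)
qed

lemma half_form_christoffel:
  assumes "u \<in> U"
  shows "B (L u (\<Gamma> u v w)) (L u z) = B (DL u v w) (L u z)"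
proof -
  have "snd (y u) \<noteq> 0"
    using height_pos[OF assms] by simp
  then show ?thesis
    unfolding half_form_tangent[OF assms] christoffel_first_form[OF assms]
      scalar_product.sharp[OF scalar_product_first_form[OF assms] linear_half_form_L[OF assms]]
    by simp
qed

text \<open>Subtracting the tangential part from \<open>DL\<close> leaves a vector orthogonal to all
  tangent vectors, to which \<open>normal_component\<close> applies. Dividing by the height refers
  the coefficient to the normal \<open>snd (y u) *\<^sub>R e u\<close>.\<close>

lemma gauss_formula_exists:
  assumes "u \<in> U"
  shows "DL u v w = L u (\<Gamma> u v w) + (\<sigma> * B (DL u v w) (e u) / snd (y u)) *\<^sub>R (snd (y u) *\<^sub>R e u)"
proof -
  have nz: "snd (y u) \<noteq> 0"
    using height_pos[OF assms] by simp
  have "DL u v w - L u (\<Gamma> u v w) = (\<sigma> * B (DL u v w - L u (\<Gamma> u v w)) (e u)) *\<^sub>R e u"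
    by (rule normal_component[OF assms]) (simp add: half_form_christoffel[OF assms])
  also have "B (DL u v w - L u (\<Gamma> u v w)) (e u) = B (DL u v w) (e u)"
    by (simp add: normal assms)
  finally have "DL u v w - L u (\<Gamma> u v w) = (\<sigma> * B (DL u v w) (e u)) *\<^sub>R e u" .
  with nz show ?thesis
    by (simp add: diff_eq_eq add.commute)
qed

text \<open>The normal is nonzero, so its coefficient in the Gauss formula is unique and the
  \<open>THE\<close> in \<open>second_form\<close> selects it.\<close>

lemma second_form_eq_normal_part:
  assumes "u \<in> U"
  shows "h u v w = \<sigma> * B (DL u v w) (e u) / snd (y u)"
proof -
  have nz: "snd (y u) \<noteq> 0" "e u \<noteq> 0"
    using height_pos[OF assms] normal_unit[OF assms] sigma_square by (auto simp: half_form.zero_left)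
  have DL: "cov_deriv_along (half_space_metric \<sigma>) y (\<lambda>u. L u w) u v = DL u v w"
    by (simp add: cov_deriv_along_def christoffel_half_space_metric[OF sigma_square] nz DL_def L2_def)
  show ?thesis
    unfolding second_form_def DL
  proof (rule the_equality)
    fix k
    assume "DL u v w = L u (\<Gamma> u v w) + k *\<^sub>R (snd (y u) *\<^sub>R e u)"
    with gauss_formula_exists[OF assms, of v w]
    have "k *\<^sub>R (snd (y u) *\<^sub>R e u) = (\<sigma> * B (DL u v w) (e u) / snd (y u)) *\<^sub>R (snd (y u) *\<^sub>R e u)"
      by (metis add_left_cancel)
    then show "k = \<sigma> * B (DL u v w) (e u) / snd (y u)"
      using nz by (metis scaleR_cancel_right scaleR_eq_0_iff)
  qed (rule gauss_formula_exists[OF assms])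
qed

lemma gauss_formula:
  assumes "u \<in> U"
  shows "DL u v w = L u (\<Gamma> u v w) + h u v w *\<^sub>R (snd (y u) *\<^sub>R e u)"
  using gauss_formula_exists[OF assms] second_form_eq_normal_part[OF assms] by metis

text \<open>Against \<open>e u\<close>, only the term of the connection containing
  \<open>snd (e u)\<close> survives. It is the source of the multiple of \<open>I\<close> in the
  Weingarten formula.\<close>

lemma second_form_eq:
  assumes "u \<in> U"
  shows "h u v w = \<sigma> * (B (L2 u v w) (e u) / snd (y u) + snd (e u) * I u v w)"
  using height_pos[OF assms]
  by (simp add: second_form_eq_normal_part[OF assms] DL_def half_form_half_space_conn[OF sigma_square]
    normal[OF assms] first_form_eq field_simps power2_eq_square)

lemma second_form_commute: "u \<in> U \<Longrightarrow> h u v w = h u w v"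
  using DL_commute[of u v w] by (simp add: second_form_eq_normal_part)

lemma linear_second_form:
  assumes "u \<in> U"
  shows "linear (h u v)"
  unfolding second_form_eq_normal_part[OF assms] using linear_DL[OF assms, of v]
  by (auto intro!: linearI simp: linear_add linear_cmul add_divide_distrib algebra_simps)

section \<open>The Weingarten formula and the fourth fundamental form\<close>

lemma weingarten_formula:
  assumes "u \<in> U"
  shows "B (dir_deriv e u v) (L u w) = snd (y u) * (snd (e u) * I u v w - \<sigma> * h u v w)"
proof -
  have 1: "((\<lambda>q. B (e q) (L q w)) has_derivative (\<lambda>v. B (e u) (L2 u v w) + B (dir_deriv e u v) (L u w))) (at u)"
    by (rule half_form.FDERIV[OF has_derivative_e[OF assms] has_derivative_L[OF assms]])
  \<comment> \<open>The pairing of normal and tangent vectors vanishes on all of the open set, so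
    its derivative at \<open>u\<close> is zero.\<close>
  have "((\<lambda>q. 0) has_derivative (\<lambda>v. B (e u) (L2 u v w) + B (dir_deriv e u v) (L u w))) (at u)"
    by (rule has_derivative_transform_within_open[OF 1 open_U assms])
      (simp add: half_form_commute[of _ "e _"] normal)
  from has_derivative_unique[OF this has_derivative_const]
  have "B (e u) (L2 u v w) + B (dir_deriv e u v) (L u w) = 0"
    by meson
  then show ?thesis
    using height_pos[OF assms] sigma_square
    by (simp add: second_form_eq[OF assms] half_form_commute[of _ "e u"] field_simps)
qed

lemma normal_deriv:
  assumes "u \<in> U"
  shows "B (dir_deriv e u v) (e u) = 0"
proof -
  have 1: "((\<lambda>q. B (e q) (e q)) has_derivative (\<lambda>v. B (e u) (dir_deriv e u v) + B (dir_deriv e u v) (e u))) (at u)"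
    by (rule half_form.FDERIV[OF has_derivative_e[OF assms] has_derivative_e[OF assms]])
  have "((\<lambda>q. \<sigma>) has_derivative (\<lambda>v. B (e u) (dir_deriv e u v) + B (dir_deriv e u v) (e u))) (at u)"
    by (rule has_derivative_transform_within_open[OF 1 open_U assms]) (simp add: normal_unit)
  from has_derivative_unique[OF this has_derivative_const]
  have "B (e u) (dir_deriv e u v) + B (dir_deriv e u v) (e u) = 0"
    by meson
  then show ?thesis
    by (simp add: half_form_commute[of _ "e u"])
qed

abbreviation "shape \<equiv> \<lambda>u v. sharp (I u) (h u v)"

lemma first_form_shape: "u \<in> U \<Longrightarrow> I u (shape u v) w = h u v w"
  by (rule scalar_product.sharp[OF scalar_product_first_form linear_second_form])

lemma third_form_eq:
  assumes "u \<in> U"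
  shows "third_form (half_space_metric \<sigma>) y e u v w = h u v (shape u w)"
  unfolding third_form_def by (rule sum_inverse_metric_eq[OF linear_second_form[OF assms]])

text \<open>Both sides pair equally with every tangent vector by \<open>weingarten_formula\<close>
  and are orthogonal to \<open>e u\<close>, so their difference has no component left.\<close>

lemma dir_deriv_gauss_map:
  assumes "u \<in> U"
  shows "dir_deriv e u v = L u ((1 / snd (y u)) *\<^sub>R (snd (e u) *\<^sub>R v - \<sigma> *\<^sub>R shape u v))"
    (is "_ = L u ?S")
proof -
  interpret scalar_product "I u"
    by (rule scalar_product_first_form[OF assms])
  have nz: "snd (y u) \<noteq> 0"
    using height_pos[OF assms] by simp
  have "dir_deriv e u v - L u ?S = (\<sigma> * B (dir_deriv e u v - L u ?S) (e u)) *\<^sub>R e u"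
  proof (rule normal_component[OF assms])
    fix z
    have "B (L u ?S) (L u z) = snd (y u) * (snd (e u) * I u v z - \<sigma> * h u v z)"
      unfolding half_form_tangent[OF assms] using nz
      by (simp add: bilinear_lmul[OF bilinear] bilinear_lsub[OF bilinear] first_form_shape[OF assms] power2_eq_square)
    then show "B (dir_deriv e u v - L u ?S) (L u z) = 0"
      by (simp add: weingarten_formula[OF assms])
  qed
  then show ?thesis
    by (simp add: normal[OF assms] normal_deriv[OF assms])
qed

theorem fourth_form_eq:
  assumes "u \<in> U"
  shows "fourth_form B e u v w = (snd (e u))\<^sup>2 * I u v w - 2 * \<sigma> * snd (e u) * h u v w
    + third_form (half_space_metric \<sigma>) y e u v w"
proof -
  interpret scalar_product "I u"
    by (rule scalar_product_first_form[OF assms])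
  have nz: "snd (y u) \<noteq> 0"
    using height_pos[OF assms] by simp
  have s: "I u v (shape u w) = h u v w"
    using first_form_shape[OF assms] sym second_form_commute[OF assms] by metis
  note h = linear_second_form[OF assms, of v]
  \<comment> \<open>Only the derivative in direction \<open>w\<close> is expanded as a tangent
    vector. Its pairing with the other factor is then given by
    \<open>weingarten_formula\<close>.\<close>
  have "fourth_form B e u v w =
      snd (e u) * (snd (e u) * I u v w - \<sigma> * h u v w) - \<sigma> * (snd (e u) * h u v w - \<sigma> * h u v (shape u w))"
    unfolding fourth_form_def dir_deriv_gauss_map[OF assms, of w] weingarten_formula[OF assms]
    using nz by (simp add: bilinear_rmul[OF bilinear] bilinear_rsub[OF bilinear] s
      linear_cmul[OF h] linear_diff[OF h] field_simps)
  \<comment> \<open>The sign \<sigma> remains in front of II but squares to 1 in front of III, hence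
    the one sign difference between the two geometries.\<close>
  also have "\<dots> = (snd (e u))\<^sup>2 * I u v w - 2 * \<sigma> * snd (e u) * h u v w + \<sigma> * \<sigma> * h u v (shape u w)"
    by (simp add: algebra_simps power2_eq_square)
  finally show ?thesis
    by (simp add: sigma_square third_form_eq[OF assms])
qed

section \<open>The Gauss equation\<close>

lemma has_derivative_DL:
  assumes "u \<in> U"
  shows "((\<lambda>q. DL q w z) has_derivative
    (\<lambda>v. dir_deriv (\<lambda>q. L2 q w z) u v
      + (conn (y u) (L2 u v w) (L u z) + conn (y u) (L u w) (L2 u v z)
        - (snd (L u v) / snd (y u)) *\<^sub>R conn (y u) (L u w) (L u z)))) (at u)"
  unfolding DL_def using height_pos[OF assms]
  by (intro has_derivative_add has_derivative_L2 has_derivative_half_space_conn has_derivative_y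
      has_derivative_L assms) simp

lemma differentiable_first_form: "u \<in> U \<Longrightarrow> (\<lambda>q. I q v w) differentiable (at u)"
  using has_derivative_first_form by (rule differentiableI)

text \<open>The \<open>THE\<close> in the definition reveals nothing about dependence on the point.
  On the open set \<open>U\<close>, \<open>christoffel_first_form\<close> replaces it by the
  solution of a linear system with differentiable coefficients.\<close>

lemma differentiable_christoffel:
  assumes "u \<in> U"
  shows "(\<lambda>q. \<Gamma> q v w) differentiable (at u)"
proof -
  let ?b = "\<lambda>q z. B (DL q v w) (L q z) / (snd (y q))\<^sup>2"
  have "(\<lambda>q. ?b q z) differentiable (at u)" for z
  proof (intro differentiable_divide differentiable_power)
    show "(\<lambda>q. B (DL q v w) (L q z)) differentiable (at u)"
      by (rule differentiableI[OF half_form.FDERIV[OF has_derivative_DL has_derivative_L]]) fact+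
    show "(\<lambda>q. snd (y q)) differentiable (at u)"
      by (rule differentiableI[OF has_derivative_snd[OF has_derivative_y]]) fact
    show "(snd (y u))\<^sup>2 \<noteq> 0"
      using height_pos[OF assms] by simp
  qed
  then have "(\<lambda>q. sharp (I q) (?b q)) differentiable (at u)"
    by (intro differentiable_sharp[OF open_U assms] scalar_product_first_form
      differentiable_first_form assms)
  then obtain D where "((\<lambda>q. sharp (I q) (?b q)) has_derivative D) (at u)"
    by (auto simp: differentiable_def)
  then have "((\<lambda>q. \<Gamma> q v w) has_derivative D) (at u)"
    by (rule has_derivative_transform_within_open[OF _ open_U assms]) (simp add: christoffel_first_form)
  then show ?thesis
    by (rule differentiableI)
qed

text \<open>Expanding the argument in the standard basis reduces the joint variation of
  \<open>L q\<close> and \<open>c q\<close> to the product rule for finitely many terms.\<close>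

lemma has_derivative_L_apply:
  assumes "u \<in> U" and c: "(c has_derivative c') (at u)"
  shows "((\<lambda>q. L q (c q)) has_derivative (\<lambda>v. L u (c' v) + L2 u v (c u))) (at u)"
proof -
  have "((\<lambda>q. \<Sum>i\<in>UNIV. (c q $ i) *\<^sub>R L q (axis i 1)) has_derivative
      (\<lambda>v. \<Sum>i\<in>UNIV. (c u $ i) *\<^sub>R L2 u v (axis i 1) + (c' v $ i) *\<^sub>R L u (axis i 1))) (at u)"
    by (intro has_derivative_sum has_derivative_scaleR has_derivative_L assms
      bounded_linear.has_derivative[OF bounded_linear_vec_nth])
  moreover have "(\<Sum>i\<in>UNIV. (c u $ i) *\<^sub>R L2 u v (axis i 1) + (c' v $ i) *\<^sub>R L u (axis i 1))
      = L u (c' v) + L2 u v (c u)" for v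
    using linear_axis_expansion[OF linear_L[OF assms(1)], of "c' v"]
      linear_axis_expansion[OF linear_L2[OF assms(1)], of v "c u"]
    by (simp add: sum.distrib)
  ultimately have "((\<lambda>q. \<Sum>i\<in>UNIV. (c q $ i) *\<^sub>R L q (axis i 1)) has_derivative
      (\<lambda>v. L u (c' v) + L2 u v (c u))) (at u)"
    by simp
  then show ?thesis
    by (rule has_derivative_transform_within_open[OF _ open_U assms(1)])
      (rule linear_axis_expansion[OF linear_L, symmetric])
qed

text \<open>The derivative of the Gauss formula, solved for the tangential part and paired with a
  tangent vector.\<close>

lemma half_form_deriv_gauss_formula:
  assumes "u \<in> U"
  shows "B (L u (dir_deriv (\<lambda>q. \<Gamma> q w z) u v) + L2 u v (\<Gamma> u w z)) (L u x) =
    B (dir_deriv (\<lambda>q. DL q w z) u v) (L u x) - h u w z * snd (y u) * B (dir_deriv e u v) (L u x)"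
proof -
  let ?k = "\<lambda>q. \<sigma> * B (DL q w z) (e q)"
  have k: "?k q = h q w z * snd (y q)" if "q \<in> U" for q
    using height_pos[OF that] by (simp add: second_form_eq_normal_part[OF that])
  note DL' = has_derivative_dir_deriv[OF differentiableI[OF has_derivative_DL[OF assms]]]
  \<comment> \<open>The value of \<open>k'\<close> may stay unspecified: it multiplies
    \<open>e u\<close> and vanishes on pairing with a tangent vector.\<close>
  obtain k' where k': "(?k has_derivative k') (at u)"
    using has_derivative_mult_right[OF half_form.FDERIV[OF DL' has_derivative_e[OF assms]]] by blast
  have "((\<lambda>q. DL q w z - ?k q *\<^sub>R e q) has_derivative
      (\<lambda>v. dir_deriv (\<lambda>q. DL q w z) u v - (?k u *\<^sub>R dir_deriv e u v + k' v *\<^sub>R e u))) (at u)"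
    by (intro has_derivative_diff has_derivative_scaleR DL' k' has_derivative_e assms)
  then have 1: "((\<lambda>q. L q (\<Gamma> q w z)) has_derivative
      (\<lambda>v. dir_deriv (\<lambda>q. DL q w z) u v - (?k u *\<^sub>R dir_deriv e u v + k' v *\<^sub>R e u))) (at u)"
    by (rule has_derivative_transform_within_open[OF _ open_U assms])
      (use k gauss_formula in \<open>simp add: diff_eq_eq\<close>)
  have 2: "((\<lambda>q. L q (\<Gamma> q w z)) has_derivative
      (\<lambda>v. L u (dir_deriv (\<lambda>q. \<Gamma> q w z) u v) + L2 u v (\<Gamma> u w z))) (at u)"
    by (rule has_derivative_L_apply[OF assms has_derivative_dir_deriv[OF differentiable_christoffel[OF assms]]])
  have "L u (dir_deriv (\<lambda>q. \<Gamma> q w z) u v) + L2 u v (\<Gamma> u w z) =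
      dir_deriv (\<lambda>q. DL q w z) u v - (?k u *\<^sub>R dir_deriv e u v + k' v *\<^sub>R e u)"
    using has_derivative_unique[OF 2 1] by meson
  moreover have "B (e u) (L u x) = 0"
    using normal[OF assms] by (simp add: half_form_commute)
  ultimately show ?thesis
    unfolding k[OF assms] by (simp only: half_form_linear) simp
qed

text \<open>The normal part of \<open>DL\<close> contributes through \<open>dir_deriv e\<close> and
  through the ambient connection. The multiples of \<open>snd (e u)\<close> in the two contributions
  cancel, leaving the product of second forms.\<close>

lemma half_form_second_cov_deriv:
  assumes "u \<in> U"
  shows "B (L u (dir_deriv (\<lambda>q. \<Gamma> q w z) u v + \<Gamma> u v (\<Gamma> u w z))) (L u x) =
    B (dir_deriv (\<lambda>q. DL q w z) u v + conn (y u) (L u v) (DL u w z)) (L u x)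
      + \<sigma> * (snd (y u))\<^sup>2 * (h u w z * h u v x)"
proof -
  let ?c = "\<Gamma> u w z" and ?k = "h u w z * snd (y u)"
  have nz: "snd (y u) \<noteq> 0"
    using height_pos[OF assms] by simp
  have "B (L u (\<Gamma> u v ?c)) (L u x) = B (L2 u v ?c) (L u x) + B (conn (y u) (L u v) (L u ?c)) (L u x)"
    by (simp add: half_form_christoffel[OF assms] DL_def)
  moreover have "B (conn (y u) (L u v) (DL u w z)) (L u x) =
      B (conn (y u) (L u v) (L u ?c)) (L u x) + ?k * B (conn (y u) (L u v) (e u)) (L u x)"
    by (subst gauss_formula[OF assms]) simp
  moreover have "B (e u) (L u x) = 0"
    using normal[OF assms] by (simp add: half_form_commute)
  then have "B (conn (y u) (L u v) (e u)) (L u x) = - snd (e u) * snd (y u) * I u v x"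
    using nz by (simp add: half_form_half_space_conn[OF sigma_square] normal[OF assms]
      half_form_tangent[OF assms] power2_eq_square)
  moreover note half_form_deriv_gauss_formula[OF assms, of w z v x] weingarten_formula[OF assms, of v x]
  ultimately show ?thesis
    by (simp add: linear_add[OF linear_L[OF assms]] algebra_simps power2_eq_square)
qed

theorem gauss_equation:
  assumes "u \<in> U"
  shows "I u (riemann I u v w z) x = - \<sigma> * (I u w z * I u v x - I u v z * I u w x)
    + \<sigma> * (h u w z * h u v x - h u v z * h u w x)"
proof -
  let ?K = "\<lambda>v w. conn (y u) (L u v) (conn (y u) (L u w) (L u z))
    - (snd (L u v) / snd (y u)) *\<^sub>R conn (y u) (L u w) (L u z)"
  have nz: "snd (y u) \<noteq> 0"
    using height_pos[OF assms] by simp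
  have D: "dir_deriv (\<lambda>q. DL q w z) u v + conn (y u) (L u v) (DL u w z) =
      dir_deriv (\<lambda>q. L2 q w z) u v + conn (y u) (L2 u v w) (L u z)
      + (conn (y u) (L u w) (L2 u v z) + conn (y u) (L u v) (L2 u w z)) + ?K v w" for v w
    unfolding dir_deriv_eq[OF has_derivative_DL[OF assms]] by (simp add: DL_def)
  let ?D = "\<lambda>v w. dir_deriv (\<lambda>q. DL q w z) u v + conn (y u) (L u v) (DL u w z)"
  let ?C = "\<lambda>v w. dir_deriv (\<lambda>q. \<Gamma> q w z) u v + \<Gamma> u v (\<Gamma> u w z)"
  \<comment> \<open>Third derivatives and all terms containing \<open>L2\<close> are symmetric in
    \<open>v\<close> and \<open>w\<close>. Only the ambient curvature terms collected in
    \<open>?K\<close> survive.\<close>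
  have "?D v w - ?D w v = ?K v w - ?K w v"
    unfolding D L3_commute[OF assms, of v z w] L2_commute[OF assms, of w v] by simp
  then have "B (?D v w) (L u x) - B (?D w v) (L u x) = B (?K v w - ?K w v) (L u x)"
    by (metis half_form.diff_left)
  moreover have "L u (riemann I u v w z) = L u (?C v w) - L u (?C w v)"
    unfolding riemann_def linear_diff[OF linear_L[OF assms], symmetric] by (simp add: algebra_simps)
  then have "B (L u (riemann I u v w z)) (L u x) = B (L u (?C v w)) (L u x) - B (L u (?C w v)) (L u x)"
    by (simp only: half_form.diff_left)
  ultimately have "B (L u (riemann I u v w z)) (L u x) = B (?K v w - ?K w v) (L u x)
      + \<sigma> * (snd (y u))\<^sup>2 * (h u w z * h u v x - h u v z * h u w x)"
    unfolding half_form_second_cov_deriv[OF assms] right_diff_distrib by linarith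
  also have "B (?K v w - ?K w v) (L u x) =
      - \<sigma> * (B (L u w) (L u z) * B (L u v) (L u x) - B (L u v) (L u z) * B (L u w) (L u x)) / (snd (y u))\<^sup>2"
    using half_space_conn_curvature[OF sigma_square nz, of "L u v" "L u w" "L u z" "L u x"]
    by (simp add: algebra_simps)
  also have "\<dots> = (snd (y u))\<^sup>2 * (- \<sigma> * (I u w z * I u v x - I u v z * I u w x))"
    unfolding half_form_tangent[OF assms] using nz by (simp add: field_simps power2_eq_square)
  finally have "(snd (y u))\<^sup>2 * I u (riemann I u v w z) x =
      (snd (y u))\<^sup>2 * (- \<sigma> * (I u w z * I u v x - I u v z * I u w x)
        + \<sigma> * (h u w z * h u v x - h u v z * h u w x))"
    unfolding half_form_tangent[OF assms] by (simp add: algebra_simps)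
  with nz show ?thesis
    by simp
qed

section \<open>The Ricci form\<close>

text \<open>Nondegeneracy lifts the Gauss equation to an identity of vectors. This is required
  because \<open>ricci\<close> sums coordinates over the standard basis, which need not be
  orthonormal for \<open>I\<close>.\<close>

lemma riemann_first_form:
  assumes "u \<in> U"
  shows "riemann I u v w z = - \<sigma> *\<^sub>R (I u w z *\<^sub>R v - I u v z *\<^sub>R w)
    + \<sigma> *\<^sub>R (h u w z *\<^sub>R shape u v - h u v z *\<^sub>R shape u w)"
proof -
  interpret scalar_product "I u"
    by (rule scalar_product_first_form[OF assms])
  show ?thesis
    by (rule nondegenerate, subst gauss_equation[OF assms])
      (simp add: bilinear_ladd[OF bilinear] bilinear_lsub[OF bilinear] bilinear_lmul[OF bilinear]
        bilinear_lneg[OF bilinear] first_form_shape[OF assms])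
qed

text \<open>Tracing the curvature over its first argument gives \<open>n - 1\<close> copies of
  \<open>I\<close> from the ambient part, and the mean curvature term minus III from the other part.
  Multiplying by \<sigma> and using \<sigma> * \<sigma> = 1 solves for III.\<close>

theorem third_form_ricci:
  assumes "u \<in> U"
  shows "third_form (half_space_metric \<sigma>) y e u w z =
    real CARD('n) * mean_curvature (half_space_metric \<sigma>) y e u * h u w z
      - (real CARD('n) - 1) * I u w z - \<sigma> * ricci I u w z"
proof -
  interpret scalar_product "I u"
    by (rule scalar_product_first_form[OF assms])
  have "linear (\<lambda>b. I u b z)"
    using bilinear by (simp add: bilinear_def)
  then have 1: "(\<Sum>b\<in>Basis. I u b z * (w \<bullet> b)) = I u w z"
    by (rule sum_Basis_inner_linear)
  have "(\<Sum>b\<in>Basis. h u b z * (shape u w \<bullet> b)) = h u z (shape u w)"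
    unfolding second_form_commute[OF assms, of _ z]
    by (rule sum_Basis_inner_linear[OF linear_second_form[OF assms]])
  \<comment> \<open>Passing through \<open>I\<close> and its symmetry exchanges the roles of
    \<open>w\<close> and \<open>z\<close>.\<close>
  also have "\<dots> = I u (shape u w) (shape u z)"
    using first_form_shape[OF assms] sym by metis
  also have "\<dots> = third_form (half_space_metric \<sigma>) y e u w z"
    by (simp add: first_form_shape[OF assms] third_form_eq[OF assms])
  finally have 2: "(\<Sum>b\<in>Basis. h u b z * (shape u w \<bullet> b)) = third_form (half_space_metric \<sigma>) y e u w z" .
  have 3: "(\<Sum>b\<in>Basis. shape u b \<bullet> b) = real CARD('n) * mean_curvature (half_space_metric \<sigma>) y e u"
    by (simp add: mean_curvature_def metric_trace_eq)
  have 4: "(\<Sum>b\<in>(Basis :: (real ^ 'n) set). b \<bullet> b) = real CARD('n)"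
    by (simp add: inner_Basis)
  have ricci: "ricci I u w z = - \<sigma> * (I u w z * (\<Sum>b\<in>(Basis :: (real ^ 'n) set). b \<bullet> b) - (\<Sum>b\<in>Basis. I u b z * (w \<bullet> b)))
      + \<sigma> * (h u w z * (\<Sum>b\<in>Basis. shape u b \<bullet> b) - (\<Sum>b\<in>Basis. h u b z * (shape u w \<bullet> b)))"
    unfolding ricci_def riemann_first_form[OF assms]
    by (simp add: inner_add_left inner_diff_left sum.distrib sum_subtractf sum_negf sum_distrib_left algebra_simps)
  show ?thesis
    unfolding ricci[unfolded 1 2 3 4] by (simp add: algebra_simps)
qed

end

section \<open>From charts to the manifold, for both signs\<close>

theorem theorem3p1:
  fixes \<A> :: "('m::{t2_space, second_countable_topology}, real ^ 'n) chart set"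
  assumes "smooth_atlas \<A>"
  shows "(\<forall>x \<eta>. immersed_hypersurface \<A> x \<and> normal_gauss_map hyperbolic_metric 1 \<A> x \<eta> \<longrightarrow>
            (\<forall>(V, \<phi>)\<in>\<A>. \<forall>p\<in>V. \<forall>v w.
              let y = in_chart (V, \<phi>) x;
                  e = in_chart (V, \<phi>) \<eta>;
                  I = first_form hyperbolic_metric y;
                  II = second_form hyperbolic_metric y e;
                  III = third_form hyperbolic_metric y e;
                  IV = fourth_form (\<bullet>) e;
                  H = mean_curvature hyperbolic_metric y e;
                  n = real CARD('n);
                  u = \<phi> p
              in IV u v w = (snd (\<eta> p))\<^sup>2 * I u v w - 2 * snd (\<eta> p) * II u v w + III u v w \<and>
                 III u v w = n * H u * II u v w - (n - 1) * I u v w - ricci I u v w))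
       \<and> (\<forall>x \<eta>. immersed_hypersurface \<A> x \<and> spacelike de_sitter_metric \<A> x \<and>
                normal_gauss_map de_sitter_metric (- 1) \<A> x \<eta> \<longrightarrow>
            (\<forall>(V, \<phi>)\<in>\<A>. \<forall>p\<in>V. \<forall>v w.
              let y = in_chart (V, \<phi>) x;
                  e = in_chart (V, \<phi>) \<eta>;
                  I = first_form de_sitter_metric y;
                  II = second_form de_sitter_metric y e;
                  III = third_form de_sitter_metric y e;
                  IV = fourth_form lorentz e;
                  H = mean_curvature de_sitter_metric y e;
                  n = real CARD('n);
                  u = \<phi> p
              in IV u v w = (snd (\<eta> p))\<^sup>2 * I u v w + 2 * snd (\<eta> p) * II u v w + III u v w \<and>
                 III u v w = n * H u * II u v w - (n - 1) * I u v w + ricci I u v w))"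
proof -
  \<comment> \<open>Positivity of the induced form is kept as a premise because its source differs
    between the two geometries; all else is uniform in \<sigma>.\<close>
  have sub: "half_space_immersion \<sigma> (\<phi> ` V) (in_chart (V, \<phi>) x) (in_chart (V, \<phi>) \<eta>)
      \<and> in_chart (V, \<phi>) \<eta> (\<phi> p) = \<eta> p"
    if \<sigma>: "\<sigma> * \<sigma> = 1" and x: "immersed_hypersurface \<A> x"
      and pos: "\<And>u v. u \<in> \<phi> ` V \<Longrightarrow> v \<noteq> 0 \<Longrightarrow>
        half_form \<sigma> (dir_deriv (in_chart (V, \<phi>) x) u v) (dir_deriv (in_chart (V, \<phi>) x) u v) > 0"
      and \<eta>: "normal_gauss_map (half_space_metric \<sigma>) \<sigma> \<A> x \<eta>"
      and V: "(V, \<phi>) \<in> \<A>" and p: "p \<in> V"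
    for \<sigma> :: real and x \<eta> :: "'m \<Rightarrow> (real ^ 'n) \<times> real" and V \<phi> p
  proof -
    have atlas: "open (\<phi> ` V)" "homeomorphism V (\<phi> ` V) \<phi> (inv_into V \<phi>)"
      using assms V by (auto simp: smooth_atlas_def)
    have chart: "in_chart (V, \<phi>) f (\<phi> q) = f q" if "q \<in> V" for f :: "'m \<Rightarrow> (real ^ 'n) \<times> real" and q
      using homeomorphism_apply1[OF atlas(2) that] by (simp add: in_chart_def)
    have height: "snd (x q) > 0" for q
      using x by (auto simp: immersed_hypersurface_def upper_half_space_def)
    have "half_space_immersion \<sigma> (\<phi> ` V) (in_chart (V, \<phi>) x) (in_chart (V, \<phi>) \<eta>)"
    proof
      show "smooth_on (\<phi> ` V) (in_chart (V, \<phi>) x)"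
        using x V by (auto simp: immersed_hypersurface_def immersion_def smooth_map_def)
      show "smooth_on (\<phi> ` V) (in_chart (V, \<phi>) \<eta>)"
        using \<eta> V by (auto simp: normal_gauss_map_def smooth_map_def)
      show "snd (in_chart (V, \<phi>) x u) > 0" if "u \<in> \<phi> ` V" for u
        using that height by (auto simp: chart)
      show "half_form \<sigma> (in_chart (V, \<phi>) \<eta> u) (in_chart (V, \<phi>) \<eta> u) = \<sigma>" if u: "u \<in> \<phi> ` V" for u
      proof -
        obtain q where q: "q \<in> V" "u = \<phi> q"
          using u by blast
        \<comment> \<open>The two height factors of the normal cancel the denominator of the
          metric.\<close>
        have "half_space_metric \<sigma> (x q) (snd (x q) *\<^sub>R \<eta> q) (snd (x q) *\<^sub>R \<eta> q) = \<sigma>"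
          using \<eta> by (simp add: normal_gauss_map_def)
        then show ?thesis
          using height[of q] by (simp add: q chart half_space_metric_def power2_eq_square)
      qed
      show "half_form \<sigma> (dir_deriv (in_chart (V, \<phi>) x) u v) (in_chart (V, \<phi>) \<eta> u) = 0"
        if u: "u \<in> \<phi> ` V" for u v
      proof -
        obtain q where q: "q \<in> V" "u = \<phi> q"
          using u by blast
        have "half_space_metric \<sigma> (x q) (dir_deriv (in_chart (V, \<phi>) x) (\<phi> q) v) (snd (x q) *\<^sub>R \<eta> q) = 0"
          using \<eta> V q by (auto simp: normal_gauss_map_def)
        then show ?thesis
          using height[of q] by (simp add: q chart half_space_metric_def)
      qed
    qed (use \<sigma> atlas pos in auto)
    with chart[OF p] show ?thesis
      by blast
  qed
  have hyperbolic: "half_space_immersion 1 (\<phi> ` V) (in_chart (V, \<phi>) x) (in_chart (V, \<phi>) \<eta>)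
      \<and> in_chart (V, \<phi>) \<eta> (\<phi> p) = \<eta> p"
    if "immersed_hypersurface \<A> x" "normal_gauss_map hyperbolic_metric 1 \<A> x \<eta>" "(V, \<phi>) \<in> \<A>" "p \<in> V"
    for x \<eta> :: "'m \<Rightarrow> (real ^ 'n) \<times> real" and V \<phi> p
  proof (rule sub)
    fix u v
    assume u: "u \<in> \<phi> ` V" and v: "(v :: real ^ 'n) \<noteq> 0"
    have "smooth_on (\<phi> ` V) (in_chart (V, \<phi>) x)" "inj (dir_deriv (in_chart (V, \<phi>) x) u)"
      using that u by (auto simp: immersed_hypersurface_def immersion_def smooth_map_def)
    \<comment> \<open>For the Euclidean scalar product, injectivity of the differential already
      gives positivity.\<close>
    then have "dir_deriv (in_chart (V, \<phi>) x) u v \<noteq> 0"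
      using linear_dir_deriv[OF smooth_on_imp_differentiable] u v by (metis linear_injective_0)
    then show "half_form 1 (dir_deriv (in_chart (V, \<phi>) x) u v) (dir_deriv (in_chart (V, \<phi>) x) u v) > 0"
      by (simp add: half_form_one)
  qed (use that in \<open>simp_all add: half_space_metric_one\<close>)
  have de_sitter: "half_space_immersion (- 1) (\<phi> ` V) (in_chart (V, \<phi>) x) (in_chart (V, \<phi>) \<eta>)
      \<and> in_chart (V, \<phi>) \<eta> (\<phi> p) = \<eta> p"
    if "immersed_hypersurface \<A> x" "spacelike de_sitter_metric \<A> x"
      "normal_gauss_map de_sitter_metric (- 1) \<A> x \<eta>" "(V, \<phi>) \<in> \<A>" "p \<in> V"
    for x \<eta> :: "'m \<Rightarrow> (real ^ 'n) \<times> real" and V \<phi> p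
  proof (rule sub)
    fix u v
    assume "u \<in> \<phi> ` V" and "(v :: real ^ 'n) \<noteq> 0"
    then have "first_form (half_space_metric (- 1)) (in_chart (V, \<phi>) x) u v v > 0"
      using that by (auto simp: spacelike_def half_space_metric_minus_one)
    then show "half_form (- 1) (dir_deriv (in_chart (V, \<phi>) x) u v) (dir_deriv (in_chart (V, \<phi>) x) u v) > 0"
      by (simp add: first_form_def half_space_metric_def zero_less_divide_iff)
  qed (use that in \<open>simp_all add: half_space_metric_minus_one\<close>)
  show ?thesis
    using half_space_immersion.fourth_form_eq[of 1] half_space_immersion.third_form_ricci[of 1]
      half_space_immersion.fourth_form_eq[of "- 1"] half_space_immersion.third_form_ricci[of "- 1"]
      hyperbolic de_sitter
    by (fastforce simp: Let_def half_space_metric_one half_space_metric_minus_one half_form_one half_form_minus_one)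
qed

end
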